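(* Let $\{f;\,f_k,k\in\mathbb{N}\}\subset\Gamma(X)$, let $E:=\{x\in X:f_k(x)\le0\ \forall k\in\mathbb{N}\}$, assume that $E\cap\operatorname{dom}f\ne\emptyset$, and let $x^*\in X^*$. The following statements are equivalent: (i) $(f+\delta_E)^*(x^* )=\min\limits_{\mu\in\mathbb{R}_+^m}\left(f+\sum_{k=1}^m\mu_kf_k\right)^*(x^* )$ for all $m\in\mathbb{N}$ sufficiently large. (ii) $\mathcal{A}$ is $w^*$-closed regarding $\{x^*\}\times\mathbb{R}$.
   Context: $X$ is a locally convex Hausdorff (real) topological vector space; its topological dual $X^*$ carries the weak*-topology and $X^*\times\mathbb{R}$ the product topology. $\Gamma(X)$ is the class of lower semicontinuous proper convex functions $X\to\mathbb{R}\cup\{+\infty\}$. The convention $0\times(+\infty)=0$ is used. $\delta_E$ is the indicator function of $E$ ($0$ on $E$, $+\infty$ elsewhere). For $h:X\to\overline{\mathbb{R}}$, $h^*(x^* )=\sup_{x\in X}\{\langle x^*,x\rangle-h(x)\}$ and $\operatorname{epi}h^*=\{(x^*,r)\in X^*\times\mathbb{R}:h^*(x^* )\le r\}$. The symbol $\min$ means that the infimum (in $\overline{\mathbb{R}}$) is attained. $\mathcal{A}:=\bigcup_{\lambda\in\mathbb{R}_+^{(\mathbb{N})}}\operatorname{epi}\left(f+\sum_{k\in\mathbb{N}}\lambda_kf_k\right)^*$, where $\mathbb{R}_+^{(\mathbb{N})}$ is the set of finitely supported sequences of nonnegative reals and the sum is over the support of $\lambda$ (equal to $0$ if the support is empty).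 A set $\mathbb{A}\subset X^*\times\mathbb{R}$ is $w^*$-closed regarding $\mathbb{B}\subset X^*\times\mathbb{R}$ if $\overline{\mathbb{A}}\cap\mathbb{B}=\mathbb{A}\cap\mathbb{B}$. *)

theory Defs
  imports "HOL-Analysis.Analysis"
begin

text \<open>Real locally convex Hausdorff topological vector spaces. The last clause in \<open>locally_convex\<close> is
  \<^term>\<open>convex V\<close>, which cannot be written inside the class specification.\<close>

class locally_convex_t2_space = real_vector + t2_space + topological_ab_group_add +
  assumes tendsto_scaleR_Pair:
    "filterlim (\<lambda>p. fst p *\<^sub>R snd p) (nhds (c *\<^sub>R x)) (nhds c \<times>\<^sub>F nhds x)"
  assumes locally_convex:
    "open U \<Longrightarrow> x \<in> U \<Longrightarrow> 
      \<exists>V. open V \<and> x \<in> V \<and> V \<subseteq> U \<and>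
        (\<forall>y\<in>V. \<forall>z\<in>V. \<forall>u\<ge>0. \<forall>v\<ge>0. u + v = 1 \<longrightarrow> u *\<^sub>R y + v *\<^sub>R z \<in> V)"

instance real_normed_vector \<subseteq> locally_convex_t2_space
proof
  fix c :: real and x :: 'a
  show "filterlim (\<lambda>p. fst p *\<^sub>R snd p) (nhds (c *\<^sub>R x)) (nhds c \<times>\<^sub>F nhds x)"
    unfolding nhds_prod[symmetric]
    by (intro tendsto_scaleR tendsto_fst[where a = "(c, x)", simplified]
        tendsto_snd[where a = "(c, x)", simplified] filterlim_ident)
next
  fix U :: "'a set" and x :: 'a
  assume "open U" "x \<in> U"
  then obtain e where "e > 0" "ball x e \<subseteq> U"
    by (auto simp: open_contains_ball)
  then show "\<exists>V. open V \<and> x \<in> V \<and> V \<subseteq> U \<and>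
      (\<forall>y\<in>V. \<forall>z\<in>V. \<forall>u\<ge>0. \<forall>v\<ge>0. u + v = 1 \<longrightarrow> u *\<^sub>R y + v *\<^sub>R z \<in> V)"
    using convex_ball[of x e] by (intro exI[of _ "ball x e"]) (auto simp: convex_def)
qed

text \<open>The dual is the set of continuous linear functionals; its weak* topology is the
  topology of pointwise convergence.\<close>

definition topological_dual :: "('a::locally_convex_t2_space \<Rightarrow> real) set" where
  "topological_dual = {xs. linear xs \<and> continuous_on UNIV xs}"

definition weak_star :: "('a::locally_convex_t2_space \<Rightarrow> real) topology" where
  "weak_star = subtopology (product_topology (\<lambda>_. euclideanreal) UNIV) topological_dual"

definition lower_semicontinuous :: "('a::topological_space \<Rightarrow> ereal) \<Rightarrow> bool" where
  "lower_semicontinuous h \<longleftrightarrow> (\<forall>x. \<forall>a < h x. \<forall>\<^sub>F y in nhds x. a < h y)"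

definition effective_domain :: "('a \<Rightarrow> ereal) \<Rightarrow> 'a set" where
  "effective_domain h = {x. h x < \<infinity>}"

definition proper :: "('a \<Rightarrow> ereal) \<Rightarrow> bool" where
  "proper h \<longleftrightarrow> (\<forall>x. h x \<noteq> -\<infinity>) \<and> effective_domain h \<noteq> {}"

text \<open>On \<open>ereal\<close> one has \<open>0 * \<infinity> = 0\<close>; the definition is only used for functions that
  omit the value \<open>-\<infinity>\<close>.\<close>

definition ereal_convex :: "('a::real_vector \<Rightarrow> ereal) \<Rightarrow> bool" where
  "ereal_convex h \<longleftrightarrow>
    (\<forall>x y. \<forall>u\<ge>0. \<forall>v\<ge>0. u + v = 1 \<longrightarrow>
      h (u *\<^sub>R x + v *\<^sub>R y) \<le> ereal u * h x + ereal v * h y)"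

definition Gamma_class :: "('a::locally_convex_t2_space \<Rightarrow> ereal) set" where
  "Gamma_class = {h. lower_semicontinuous h \<and> proper h \<and> ereal_convex h}"

definition delta :: "'a set \<Rightarrow> 'a \<Rightarrow> ereal" where
  "delta E x = (if x \<in> E then 0 else \<infinity>)"

definition conjugate :: "('a \<Rightarrow> ereal) \<Rightarrow> ('a \<Rightarrow> real) \<Rightarrow> ereal" where
  "conjugate h xs = (SUP x. ereal (xs x) - h x)"

definition epi_conjugate ::
    "('a::locally_convex_t2_space \<Rightarrow> ereal) \<Rightarrow> (('a \<Rightarrow> real) \<times> real) set" where
  "epi_conjugate h = {(xs, r). xs \<in> topological_dual \<and> conjugate h xs \<le> ereal r}"

text \<open>Sequences are indexed by the positive integers: the value at index \<open>0\<close> of a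
  family \<open>g\<close> is never used, and finitely supported multipliers vanish there.\<close>

definition feasible_set :: "(nat \<Rightarrow> 'a \<Rightarrow> ereal) \<Rightarrow> 'a set" where
  "feasible_set g = {x. \<forall>k\<ge>1. g k x \<le> 0}"

definition nonneg_finsupp :: "(nat \<Rightarrow> real) set" where
  "nonneg_finsupp =
    {l. (\<forall>k. 0 \<le> l k) \<and> finite {k. l k \<noteq> 0} \<and> {k. l k \<noteq> 0} \<subseteq> {1..}}"

definition epi_union ::
    "('a::locally_convex_t2_space \<Rightarrow> ereal) \<Rightarrow> (nat \<Rightarrow> 'a \<Rightarrow> ereal) \<Rightarrow> (('a \<Rightarrow> real) \<times> real) set"
  where
  "epi_union f g =
    (\<Union>l\<in>nonneg_finsupp. epi_conjugate (\<lambda>x. f x + (\<Sum>k | l k \<noteq> 0. ereal (l k) * g k x)))"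

definition weak_star_closed_regarding ::
    "(('a::locally_convex_t2_space \<Rightarrow> real) \<times> real) set \<Rightarrow> (('a \<Rightarrow> real) \<times> real) set \<Rightarrow> bool"
  where
  "weak_star_closed_regarding A B \<longleftrightarrow>
    (prod_topology weak_star euclideanreal closure_of A) \<inter> B = A \<inter> B"

text \<open>\<open>v = min\<^bsub>u\<in>S\<^esub> F u\<close>: the infimum, possibly infinite, equals \<open>v\<close> and is attained.\<close>

definition is_attained_min :: "ereal \<Rightarrow> 'b set \<Rightarrow> ('b \<Rightarrow> ereal) \<Rightarrow> bool" where
  "is_attained_min v S F \<longleftrightarrow> v = (INF u\<in>S. F u) \<and> (\<exists>u\<in>S. F u = (INF u\<in>S. F u))"

end

theory Submission
  imports Defs "HOL-Analysis.Finite_Function_Topology"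
begin

text \<open>
  Write \<open>L\<^sub>l = f + (\<Sum>k. l\<^sub>k f\<^sub>k)\<close> for the Lagrangian with multiplier \<open>l\<close>, and \<open>A\<close> for the union of the
  sets \<open>epi (L\<^sub>l)\<^sup>*\<close>. The theorem follows from one identity,
  \<open>cl A = epi (f + \<delta>\<^sub>E)\<^sup>*\<close> in the weak* topology (\<open>closure_epi_union\<close>). Indeed, let \<open>v = (f + \<delta>\<^sub>E)\<^sup>*(x\<^sup>*)\<close>. By the
  identity, closedness of \<open>A\<close> regarding \<open>{x\<^sup>*} \<times> \<real>\<close> says that \<open>v \<le> r\<close> if and only if
  \<open>(L\<^sub>l)\<^sup>*(x\<^sup>*) \<le> r\<close> for some \<open>l\<close>. As \<open>v \<le> (L\<^sub>l)\<^sup>*(x\<^sup>*)\<close> for every \<open>l\<close>, and \<open>v\<close> is not \<open>-\<infinity>\<close>, this means that some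
  \<open>l\<close> attains \<open>v\<close>; and as \<open>l\<close> has finite support, it is a competitor in \<open>\<real>\<^sub>+\<^sup>m\<close> for all large \<open>m\<close>.

  One inclusion of the identity is weak duality, because \<open>epi (f + \<delta>\<^sub>E)\<^sup>*\<close> is an intersection of closed half-spaces
  (\<open>closure_epi_union_sound\<close>). For the other one (\<open>closure_epi_union_complete\<close>), \<open>A\<close> is convex. If
  \<open>(x\<^sup>*, r)\<close> is not in its closure, then finitely many evaluations separate them, so there are a point \<open>z\<close>
  and a \<open>\<tau> \<ge> 0\<close> with \<open>\<langle>y, z\<rangle> - \<tau> s \<le> \<langle>x\<^sup>*, z\<rangle> - \<tau> r - \<epsilon>\<close> for all \<open>(y, s) \<in> A\<close>. Adding a small multiple \<open>\<delta>\<close> of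
  \<open>\<langle>y, x\<^sub>1\<rangle> - s \<le> f x\<^sub>1\<close>, where \<open>x\<^sub>1 \<in> E \<inter> dom f\<close>, makes the coefficient of \<open>s\<close> nonzero, also when
  \<open>\<tau> = 0\<close>. After division by it, all affine minorants in \<open>A\<close> are bounded at the point \<open>w = (z + \<delta> x\<^sub>1) / (\<tau> + \<delta>)\<close>. By
  the Fenchel-Moreau theorem, the supremum of these minorants is \<open>sup\<^sub>l L\<^sub>l = f + \<delta>\<^sub>E\<close>, and the bound on \<open>(f + \<delta>\<^sub>E)(w)\<close>
  contradicts \<open>(x\<^sup>*, r) \<in> epi (f + \<delta>\<^sub>E)\<^sup>*\<close>.

  Both uses of Hahn-Banach, the Fenchel-Moreau theorem (\<open>affine_minorant\<close>) and the separation
  (\<open>weak_star_separation\<close>), are instances of the Mazur-Orlicz theorem (\<open>mazur_orlicz\<close>), which is proved here with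
  Zorn's lemma: a minimal sublinear functional is linear.
\<close>

section \<open>Sublinear functionals and the Mazur-Orlicz theorem\<close>

definition sublinear :: "('v::real_vector \<Rightarrow> real) \<Rightarrow> bool" where
  "sublinear p \<longleftrightarrow>
    (\<forall>x y. p (x + y) \<le> p x + p y) \<and> (\<forall>t>0. \<forall>x. p (t *\<^sub>R x) = t * p x)"

lemma sublinear_add: "sublinear p \<Longrightarrow> p (x + y) \<le> p x + p y"
  by (simp add: sublinear_def)

lemma sublinear_zero: assumes "sublinear p" shows "p 0 = 0"
proof -
  have "p (2 *\<^sub>R 0) = 2 * p 0"
    using assms unfolding sublinear_def by (metis zero_less_numeral)
  then show ?thesis by simp
qed

lemma sublinear_scaleR: "sublinear p \<Longrightarrow> 0 \<le> t \<Longrightarrow> p (t *\<^sub>R x) = t * p x"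
  by (cases "t = 0") (auto simp: sublinear_zero sublinear_def)

lemma sublinear_minus_ge: assumes "sublinear p" shows "- p (- x) \<le> p x"
  using sublinear_add[OF assms, of x "- x"] sublinear_zero[OF assms] by simp

lemma sublinearI:
  assumes "\<And>x y. p (x + y) \<le> p x + p y" "\<And>t x. t > 0 \<Longrightarrow> p (t *\<^sub>R x) \<le> t * p x"
  shows "sublinear p"
  unfolding sublinear_def
proof (intro conjI allI impI)
  fix t :: real and x assume t: "t > 0"
  have "p ((1 / t) *\<^sub>R (t *\<^sub>R x)) \<le> 1 / t * p (t *\<^sub>R x)"
    using t by (intro assms(2)) auto
  then have "t * p x \<le> p (t *\<^sub>R x)" using t by (simp add: field_simps)
  then show "p (t *\<^sub>R x) = t * p x" using assms(2)[OF t, of x] by linarith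
qed (rule assms(1))

text \<open>The functional \<open>q x = inf {p (x + t v) + t c | t \<ge> 0, (v, c) \<in> S}\<close> serves: \<open>t = 0\<close> gives \<open>q \<le> p\<close>, and
  \<open>t = 1\<close> at \<open>x = -v\<close> gives \<open>q (-v) \<le> c\<close>. The infimum is finite because \<open>p (x + t v) + t c\<close> is at least
  \<open>t (p v + c) - p (-x)\<close>; it is subadditive because \<open>S\<close> is convex. This one construction is used twice: to
  build the constraint of the Mazur-Orlicz theorem into \<open>p\<close>, and, with \<open>S\<close> a single point, to show that minimal
  sublinear functionals are linear.\<close>

lemma sublinear_tilt:
  assumes p: "sublinear p" and S: "convex S" "S \<noteq> {}"
    and nonneg: "\<And>v c. (v, c) \<in> S \<Longrightarrow> 0 \<le> p v + c"
  shows "\<exists>q. sublinear q \<and> (\<forall>x. q x \<le> p x) \<and> (\<forall>(v, c)\<in>S. q (- v) \<le> c)"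
proof -
  define T where "T x = {p (x + t *\<^sub>R v) + t * c | t v c. 0 \<le> t \<and> (v, c) \<in> S}" for x
  define q where "q x = Inf (T x)" for x
  have lower: "- p (- x) \<le> p (x + t *\<^sub>R v) + t * c" if "0 \<le> t" "(v, c) \<in> S" for x t v c
  proof -
    have "p (t *\<^sub>R v) \<le> p (x + t *\<^sub>R v) + p (- x)"
      using sublinear_add[OF p, of "x + t *\<^sub>R v" "- x"] by simp
    moreover have "0 \<le> t * (p v + c)" using that nonneg by simp
    ultimately show ?thesis
      using sublinear_scaleR[OF p that(1), of v] by (simp add: algebra_simps)
  qed
  have bdd: "bdd_below (T x)" for x
    by (rule bdd_belowI[of _ "- p (- x)"]) (auto simp: T_def lower)
  have ne: "T x \<noteq> {}" for x using S(2) by (fastforce simp: T_def)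
  have q_le: "q x \<le> p (x + t *\<^sub>R v) + t * c" if "0 \<le> t" "(v, c) \<in> S" for x t v c
    unfolding q_def by (rule cInf_lower[OF _ bdd]) (use that in \<open>auto simp: T_def\<close>)
  have q_ge: "B \<le> q x" if "\<And>t v c. 0 \<le> t \<Longrightarrow> (v, c) \<in> S \<Longrightarrow> B \<le> p (x + t *\<^sub>R v) + t * c" for B x
    unfolding q_def by (rule cInf_greatest[OF ne]) (use that in \<open>auto simp: T_def\<close>)
  have q_le_p: "q x \<le> p x" for x
  proof -
    obtain v c where "(v, c) \<in> S" using S(2) by auto
    from q_le[OF _ this, of 0 x] show ?thesis by simp
  qed
  have q_add2: "q (x + y) \<le> (p (x + t *\<^sub>R v) + t * c) + (p (y + s *\<^sub>R w) + s * d)"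
    if *: "0 \<le> t" "(v, c) \<in> S" "0 \<le> s" "(w, d) \<in> S" for x y t v c s w d
  proof (cases "t + s = 0")
    case True
    then have "t = 0" "s = 0" using * by auto
    then show ?thesis using q_le_p[of "x + y"] sublinear_add[OF p, of x y] by simp
  next
    case False
    \<comment> \<open>Two competitors with weights \<open>t\<close> and \<open>s\<close> merge into one of weight \<open>t + s\<close> at a convex combination.\<close>
    define r where "r = t + s"
    have r: "r > 0" using False * by (simp add: r_def)
    have "(t / r) *\<^sub>R (v, c) + (s / r) *\<^sub>R (w, d) \<in> S"
      using * r by (intro convexD[OF S(1)]) (auto simp: r_def simp flip: add_divide_distrib)
    then have mem: "((t / r) *\<^sub>R v + (s / r) *\<^sub>R w, (t / r) * c + (s / r) * d) \<in> S" by simp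
    have "q (x + y) \<le> p (x + y + r *\<^sub>R ((t / r) *\<^sub>R v + (s / r) *\<^sub>R w)) + r * ((t / r) * c + (s / r) * d)"
      by (rule q_le[OF _ mem]) (use r in simp)
    also have "\<dots> = p ((x + t *\<^sub>R v) + (y + s *\<^sub>R w)) + (t * c + s * d)"
      using r by (simp add: scaleR_add_right algebra_simps)
    also have "\<dots> \<le> (p (x + t *\<^sub>R v) + p (y + s *\<^sub>R w)) + (t * c + s * d)"
      using sublinear_add[OF p] by (intro add_right_mono)
    finally show ?thesis by simp
  qed
  have "sublinear q"
  proof (rule sublinearI)
    fix x y
    have "q (x + y) - (p (x + t *\<^sub>R v) + t * c) \<le> q y" if "0 \<le> t" "(v, c) \<in> S" for t v c
      using q_add2[OF that, of _ _ _ x y] by (intro q_ge) (auto simp: algebra_simps)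
    then have "q (x + y) - q y \<le> q x" by (intro q_ge) (auto simp: algebra_simps)
    then show "q (x + y) \<le> q x + q y" by simp
  next
    fix t :: real and x assume t: "t > 0"
    have "q (t *\<^sub>R x) / t \<le> q x"
    proof (rule q_ge)
      fix s v c assume *: "0 \<le> (s::real)" "(v, c) \<in> S"
      have "q (t *\<^sub>R x) \<le> p (t *\<^sub>R x + (t * s) *\<^sub>R v) + (t * s) * c"
        using * t by (intro q_le) auto
      also have "t *\<^sub>R x + (t * s) *\<^sub>R v = t *\<^sub>R (x + s *\<^sub>R v)" by (simp add: scaleR_add_right)
      also have "p \<dots> = t * p (x + s *\<^sub>R v)" using t by (intro sublinear_scaleR[OF p]) auto
      finally show "q (t *\<^sub>R x) / t \<le> p (x + s *\<^sub>R v) + s * c"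
        using t by (simp add: field_simps)
    qed
    then show "q (t *\<^sub>R x) \<le> t * q x" using t by (simp add: field_simps)
  qed
  moreover have "q (- v) \<le> c" if "(v, c) \<in> S" for v c
    using q_le[OF _ that, of 1 "- v"] sublinear_zero[OF p] by simp
  ultimately show ?thesis using q_le_p by blast
qed

text \<open>A pointwise infimum of sublinear functionals is subadditive only because two members of a chain can be
  replaced by the smaller of them.\<close>

lemma sublinear_Inf_chain:
  assumes C: "C \<noteq> {}" "\<And>r. r \<in> C \<Longrightarrow> sublinear r"
    and chain: "\<And>r s. r \<in> C \<Longrightarrow> s \<in> C \<Longrightarrow> r \<le> s \<or> s \<le> r"
    and bdd: "\<And>x. bdd_below ((\<lambda>r. r x) ` C)"
  shows "sublinear (\<lambda>x. INF r\<in>C. r x)" (is "sublinear ?u")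
proof (rule sublinearI)
  fix x y
  have pair: "?u (x + y) \<le> r x + s y" if rs: "r \<in> C" "s \<in> C" for r s
  proof -
    obtain m where m: "m \<in> C" "m \<le> r" "m \<le> s" using chain[OF rs] rs by blast
    have "?u (x + y) \<le> m (x + y)" by (rule cINF_lower[OF bdd m(1)])
    also have "\<dots> \<le> m x + m y" by (rule sublinear_add[OF C(2)[OF m(1)]])
    also have "\<dots> \<le> r x + s y" using m by (intro add_mono) (auto simp: le_fun_def)
    finally show ?thesis .
  qed
  have "?u (x + y) - r x \<le> ?u y" if r: "r \<in> C" for r
  proof (rule cINF_greatest[OF C(1)])
    show "?u (x + y) - r x \<le> s y" if "s \<in> C" for s using pair[OF r that] by linarith
  qed
  then have "?u (x + y) - ?u y \<le> ?u x"
    by (intro cINF_greatest[OF C(1)]) (simp add: algebra_simps)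
  then show "?u (x + y) \<le> ?u x + ?u y" by simp
next
  fix t :: real and x assume t: "t > 0"
  have "?u (t *\<^sub>R x) / t \<le> ?u x"
  proof (rule cINF_greatest[OF C(1)])
    fix r assume r: "r \<in> C"
    have "?u (t *\<^sub>R x) \<le> r (t *\<^sub>R x)" by (rule cINF_lower[OF bdd r])
    then show "?u (t *\<^sub>R x) / t \<le> r x"
      using sublinear_scaleR[OF C(2)[OF r], of t x] t by (simp add: field_simps)
  qed
  then show "?u (t *\<^sub>R x) \<le> t * ?u x" using t by (simp add: field_simps)
qed

text \<open>Zorn's lemma applies because every sublinear \<open>r \<le> q\<close> satisfies \<open>r x \<ge> - r (-x) \<ge> - q (-x)\<close>, which
  bounds chains from below pointwise.\<close>

lemma minimal_sublinear_exists:
  assumes q: "sublinear q"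
  obtains m where "sublinear m" "m \<le> q" "\<And>r. sublinear r \<Longrightarrow> r \<le> m \<Longrightarrow> r = m"
proof -
  define A where "A = {r. sublinear r \<and> r \<le> q}"
  have "\<exists>m\<in>A. \<forall>r\<in>A. r \<le> m \<longrightarrow> r = m"
  proof (rule predicate_Zorn[of A "\<lambda>a b. b \<le> a"])
    show "partial_order_on A (relation_of (\<lambda>a b. b \<le> a) A)"
      by (rule partial_order_on_relation_ofI) auto
  next
    fix C assume CC: "C \<in> Chains (relation_of (\<lambda>a b. b \<le> a) A)"
    have CA: "C \<subseteq> A" by (rule Chains_relation_of[OF CC])
    show "\<exists>u\<in>A. \<forall>a\<in>C. u \<le> a"
    proof (cases "C = {}")
      case True
      then show ?thesis using q by (auto simp: A_def)
    next
      case False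
      have bdd: "bdd_below ((\<lambda>r. r x) ` C)" for x
      proof (rule bdd_belowI[of _ "- q (- x)"])
        fix b assume "b \<in> (\<lambda>r. r x) ` C"
        then obtain r where r: "r \<in> A" "b = r x" using CA by auto
        have "- r (- x) \<le> r x" using r by (intro sublinear_minus_ge) (auto simp: A_def)
        moreover have "r (- x) \<le> q (- x)" using r by (auto simp: A_def le_fun_def)
        ultimately show "- q (- x) \<le> b" using r(2) by linarith
      qed
      let ?u = "\<lambda>x. INF r\<in>C. r x"
      have "sublinear ?u"
        by (rule sublinear_Inf_chain[OF False _ _ bdd])
          (use CA CC in \<open>auto simp: A_def Chains_def relation_of_def\<close>)
      moreover have le: "?u \<le> r" if "r \<in> C" for r
        using cINF_lower[OF bdd that] by (simp add: le_fun_def)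
      moreover have "?u \<le> q"
      proof -
        obtain r where r: "r \<in> C" using False by auto
        then have "r \<le> q" using CA by (auto simp: A_def)
        then show ?thesis using le[OF r] by (rule order_trans[rotated])
      qed
      ultimately show ?thesis by (intro bexI[of _ ?u]) (auto simp: A_def)
    qed
  qed
  then obtain m where m: "m \<in> A" "\<And>r. r \<in> A \<Longrightarrow> r \<le> m \<Longrightarrow> r = m" by blast
  show thesis
  proof (rule that)
    show "sublinear m" "m \<le> q" using m(1) by (auto simp: A_def)
    show "r = m" if "sublinear r" "r \<le> m" for r
      using that m(1) by (intro m(2)) (auto simp: A_def intro: order_trans)
  qed
qed

text \<open>Tilting \<open>m\<close> by the pair \<open>(z, - m z)\<close> gives a sublinear functional below \<open>m\<close>, which by minimality is
  \<open>m\<close>; hence \<open>m (-z) \<le> - m z\<close>, so \<open>m\<close> is odd, and an odd sublinear functional is linear.\<close>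

lemma minimal_sublinear_linear:
  assumes m: "sublinear m" and min: "\<And>r. sublinear r \<Longrightarrow> r \<le> m \<Longrightarrow> r = m"
  shows "linear m"
proof -
  have odd: "m (- z) = - m z" for z
  proof -
    obtain r where r: "sublinear r" "\<forall>x. r x \<le> m x" "r (- z) \<le> - m z"
      using sublinear_tilt[OF m, of "{(z, - m z)}"] by auto
    then have "r = m" using min by (simp add: le_fun_def)
    then show ?thesis using r(3) sublinear_minus_ge[OF m, of "- z"] by simp
  qed
  show ?thesis
  proof (rule linearI)
    fix x y
    have "m x \<le> m (x + y) + m (- y)" using sublinear_add[OF m, of "x + y" "- y"] by simp
    then show "m (x + y) = m x + m y" using sublinear_add[OF m, of x y] odd[of y] by simp
  next
    fix t :: real and x
    show "m (t *\<^sub>R x) = t *\<^sub>R m x"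
    proof (cases "0 \<le> t")
      case True then show ?thesis by (simp add: sublinear_scaleR[OF m])
    next
      case False
      then have "m ((- t) *\<^sub>R x) = (- t) * m x" by (intro sublinear_scaleR[OF m]) auto
      then show ?thesis using odd[of "t *\<^sub>R x"] by simp
    qed
  qed
qed

text \<open>This is the Hahn-Banach theorem in the sandwich form of Mazur and Orlicz. A pair \<open>(v, c) \<in> S\<close> is the constraint
  \<open>\<phi> v \<ge> - c\<close>, which by linearity is \<open>\<phi> (- v) \<le> c\<close>; this holds for every minorant of the tilted functional.\<close>

theorem mazur_orlicz:
  assumes p: "sublinear p" and S: "convex S"
    and nonneg: "\<And>v c. (v, c) \<in> S \<Longrightarrow> 0 \<le> p v + c"
  shows "\<exists>\<phi>. linear \<phi> \<and> (\<forall>x. \<phi> x \<le> p x) \<and> (\<forall>(v, c)\<in>S. 0 \<le> \<phi> v + c)"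
proof -
  obtain q where q: "sublinear q" "\<And>x. q x \<le> p x" "\<And>v c. (v, c) \<in> S \<Longrightarrow> q (- v) \<le> c"
  proof (cases "S = {}")
    case True
    then show ?thesis using p that by auto
  next
    case False
    from sublinear_tilt[OF p S False nonneg] show ?thesis using that by blast
  qed
  obtain m where m: "sublinear m" "m \<le> q" "\<And>r. sublinear r \<Longrightarrow> r \<le> m \<Longrightarrow> r = m"
    by (rule minimal_sublinear_exists[OF q(1)]) (rule that)
  have lin: "linear m" by (rule minimal_sublinear_linear[OF m(1,3)])
  have le: "m x \<le> q x" for x using m(2) by (simp add: le_fun_def)
  have "m x \<le> p x" for x using le[of x] q(2)[of x] by linarith
  moreover have "0 \<le> m v + c" if "(v, c) \<in> S" for v c
    using le[of "- v"] q(3)[OF that] linear_neg[OF lin, of v] by simp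
  ultimately show ?thesis using lin by blast
qed

section \<open>Neighbourhoods in locally convex spaces\<close>

text \<open>The Minkowski functional of \<open>V\<close>. It turns a convex neighbourhood of the origin into a sublinear
  functional for the Mazur-Orlicz theorem.\<close>

lemma gauge_exists:
  assumes V: "convex V" and absorb: "\<And>x. \<exists>t>0. t *\<^sub>R x \<in> V"
  obtains p where "sublinear p" "\<And>x. 0 \<le> p x" "\<And>x. p x < 1 \<Longrightarrow> x \<in> V" "\<And>x. x \<in> V \<Longrightarrow> p x \<le> 1"
proof -
  define T where "T x = {t. 0 < t \<and> (1 / t) *\<^sub>R x \<in> V}" for x
  define p where "p x = Inf (T x)" for x
  have zero: "0 \<in> V" using absorb[of 0] by simp
  have ne: "T x \<noteq> {}" for x
  proof -
    obtain t where "t > 0" "t *\<^sub>R x \<in> V" using absorb by blast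
    then have "1 / t \<in> T x" by (simp add: T_def)
    then show ?thesis by blast
  qed
  have bdd: "bdd_below (T x)" for x by (rule bdd_belowI[of _ 0]) (auto simp: T_def)
  have p_le: "p x \<le> t" if "0 < t" "(1 / t) *\<^sub>R x \<in> V" for x t
    unfolding p_def by (rule cInf_lower[OF _ bdd]) (use that in \<open>auto simp: T_def\<close>)
  have p_ge: "B \<le> p x" if "\<And>t. 0 < t \<Longrightarrow> (1 / t) *\<^sub>R x \<in> V \<Longrightarrow> B \<le> t" for B x
    unfolding p_def by (rule cInf_greatest[OF ne]) (use that in \<open>auto simp: T_def\<close>)
  show thesis
  proof (rule that)
    show "sublinear p"
    proof (rule sublinearI)
      fix x y
      have *: "p (x + y) \<le> s + t" if st: "0 < s" "(1 / s) *\<^sub>R x \<in> V" "0 < t" "(1 / t) *\<^sub>R y \<in> V" for s t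
      proof (rule p_le)
        have "(s / (s + t)) *\<^sub>R ((1 / s) *\<^sub>R x) + (t / (s + t)) *\<^sub>R ((1 / t) *\<^sub>R y) \<in> V"
          using st by (intro convexD[OF V]) (auto simp flip: add_divide_distrib)
        then show "(1 / (s + t)) *\<^sub>R (x + y) \<in> V"
          using st by (simp add: scaleR_add_right)
      qed (use st in simp)
      have "p (x + y) - s \<le> p y" if "0 < s" "(1 / s) *\<^sub>R x \<in> V" for s
        using *[OF that] by (intro p_ge) (simp add: algebra_simps)
      then have "p (x + y) - p y \<le> p x" by (intro p_ge) (simp add: algebra_simps)
      then show "p (x + y) \<le> p x + p y" by simp
    next
      fix t :: real and x assume t: "t > 0"
      have "p (t *\<^sub>R x) / t \<le> p x"
      proof (rule p_ge)
        fix s assume s: "0 < s" "(1 / s) *\<^sub>R x \<in> V"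
        have "p (t *\<^sub>R x) \<le> t * s" by (rule p_le) (use s t in auto)
        then show "p (t *\<^sub>R x) / t \<le> s" using t by (simp add: field_simps)
      qed
      then show "p (t *\<^sub>R x) \<le> t * p x" using t by (simp add: field_simps)
    qed
    show "0 \<le> p x" for x by (rule p_ge) simp
    show "x \<in> V" if less: "p x < 1" for x
    proof -
      obtain t where t: "t > 0" "(1 / t) *\<^sub>R x \<in> V" "t < 1"
        using less p_ge[of x 1] by (meson not_le)
      \<comment> \<open>The point \<open>x\<close> lies between the origin and \<open>x / t\<close>.\<close>
      have "t *\<^sub>R ((1 / t) *\<^sub>R x) + (1 - t) *\<^sub>R 0 \<in> V"
        using t zero by (intro convexD[OF V]) auto
      then show ?thesis using t by simp
    qed
    show "p x \<le> 1" if "x \<in> V" for x by (rule p_le) (use that in auto)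
  qed
qed

lemma tendsto_scaleR_lcs:
  fixes x :: "'a::locally_convex_t2_space"
  assumes "(a \<longlongrightarrow> c) F" "(b \<longlongrightarrow> x) F"
  shows "((\<lambda>z. a z *\<^sub>R b z) \<longlongrightarrow> c *\<^sub>R x) F"
  using filterlim_compose[OF tendsto_scaleR_Pair filterlim_Pair[OF assms]] by simp

lemma open_nhd_absorbing:
  fixes V :: "'a::locally_convex_t2_space set"
  assumes "open V" "0 \<in> V"
  shows "\<exists>t>0. t *\<^sub>R x \<in> V"
proof -
  have "((\<lambda>t. t *\<^sub>R x) \<longlongrightarrow> 0 *\<^sub>R x) (at_right 0)"
    by (intro tendsto_scaleR_lcs tendsto_const tendsto_ident_at)
  then have "\<forall>\<^sub>F t in at_right 0. t *\<^sub>R x \<in> V"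
    using topological_tendstoD[of _ "0 *\<^sub>R x" _ V] assms by simp
  then have "\<forall>\<^sub>F t in at_right 0. t *\<^sub>R x \<in> V \<and> t > (0::real)"
    using eventually_at_right_less by (rule eventually_conj)
  from eventually_happens[OF this] show ?thesis by auto
qed

lemma symmetric_convex_nhd:
  fixes U :: "'a::locally_convex_t2_space set"
  assumes "open U" "0 \<in> U"
  obtains V where "open V" "convex V" "0 \<in> V" "V \<subseteq> U" "\<And>v. v \<in> V \<Longrightarrow> - v \<in> V"
proof -
  obtain W where W: "open W" "0 \<in> W" "W \<subseteq> U" and
    comb: "\<forall>y\<in>W. \<forall>z\<in>W. \<forall>u\<ge>0. \<forall>v\<ge>0. u + v = 1 \<longrightarrow> u *\<^sub>R y + v *\<^sub>R z \<in> W"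
    using locally_convex[OF assms] by (elim exE conjE) (rule that)
  have cW: "convex W" unfolding convex_def by (rule comb)
  have m: "open (uminus -` W)"
    using W(1) by (intro open_vimage continuous_on_minus continuous_on_id)
  have "convex (uminus -` W)"
    by (intro convex_linear_vimage cW linear_uminus)
  then show thesis
    using W m cW by (intro that[of "W \<inter> uminus -` W"]) (auto intro: convex_Int)
qed

lemma linear_bounded_on_nhd_continuous:
  fixes \<phi> :: "'a::locally_convex_t2_space \<Rightarrow> real"
  assumes lin: "linear \<phi>" and V: "open V" "0 \<in> V" and bound: "\<And>v. v \<in> V \<Longrightarrow> \<bar>\<phi> v\<bar> \<le> K"
  shows "\<phi> \<in> topological_dual"
proof -
  have "(\<phi> \<longlongrightarrow> \<phi> x) (at x)" for x
  proof (rule tendstoI)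
    fix e :: real assume e: "e > 0"
    define c where "c = (\<bar>K\<bar> + 1) / e"
    have c: "c > 0" using e by (simp add: c_def add_nonneg_pos)
    have "((\<lambda>y. c *\<^sub>R (y - x)) \<longlongrightarrow> c *\<^sub>R (x - x)) (at x)"
      by (intro tendsto_scaleR_lcs tendsto_const tendsto_diff tendsto_ident_at)
    then have "\<forall>\<^sub>F y in at x. c *\<^sub>R (y - x) \<in> V"
      using V by (intro topological_tendstoD[of _ "c *\<^sub>R (x - x)"]) auto
    then show "\<forall>\<^sub>F y in at x. dist (\<phi> y) (\<phi> x) < e"
    proof (rule eventually_mono)
      fix y assume "c *\<^sub>R (y - x) \<in> V"
      then have "\<bar>\<phi> (c *\<^sub>R (y - x))\<bar> \<le> K" by (rule bound)
      moreover have "\<phi> (c *\<^sub>R (y - x)) = c * (\<phi> y - \<phi> x)"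
        using lin by (simp add: linear_scale linear_diff)
      ultimately have "c * \<bar>\<phi> y - \<phi> x\<bar> < c * e" using c e by (simp add: abs_mult c_def)
      then show "dist (\<phi> y) (\<phi> x) < e"
        using c by (simp add: dist_real_def)
    qed
  qed
  then show ?thesis
    using lin by (simp add: topological_dual_def continuous_on_def)
qed

section \<open>Lower semicontinuous convex functions\<close>

lemma ereal_convexD:
  "ereal_convex h \<Longrightarrow> 0 \<le> u \<Longrightarrow> 0 \<le> v \<Longrightarrow> u + v = 1 \<Longrightarrow>
    h (u *\<^sub>R x + v *\<^sub>R y) \<le> ereal u * h x + ereal v * h y"
  by (simp add: ereal_convex_def)

text \<open>The nontrivial half of the Fenchel-Moreau theorem. It suffices to find a sublinear \<open>n p\<close>, with \<open>p\<close> the gauge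
  of a neighbourhood of the origin, such that \<open>h (x0 + v) + n p v \<ge> a\<close> for all \<open>v\<close>: then Mazur-Orlicz gives a linear
  \<open>\<phi> \<le> n p\<close>, hence a continuous one, with \<open>h (x0 + v) + \<phi> v \<ge> a\<close>. Where \<open>p v < 1\<close>, lower
  semicontinuity at \<open>x0\<close> gives the inequality. Elsewhere it holds for large \<open>n\<close>, because convexity and lower semicontinuity
  at a point \<open>x1\<close> of the domain force \<open>h\<close> to decrease at most linearly in \<open>p\<close>. No vertical hyperplane can
  arise in this way, so the case \<open>h x0 = \<infinity>\<close> needs no separate argument.\<close>

theorem affine_minorant:
  fixes h :: "'a::locally_convex_t2_space \<Rightarrow> ereal"
  assumes lsc: "lower_semicontinuous h" and conv: "ereal_convex h"
    and not_MInf: "\<And>x. h x \<noteq> -\<infinity>" and fin: "h x1 < \<infinity>" and a: "ereal a < h x0"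
  obtains y s where "y \<in> topological_dual" "\<And>x. ereal (y x - s) \<le> h x" "a \<le> y x0 - s"
proof -
  obtain b where b: "h x1 = ereal b"
    using fin not_MInf[of x1] by (cases "h x1") auto
  have ev: "\<exists>W. open W \<and> 0 \<in> W \<and> (\<forall>v\<in>W. ereal d < h (x + v))" if d: "ereal d < h x" for d x
  proof -
    obtain W where W: "open W" "x \<in> W" "\<forall>y\<in>W. ereal d < h y"
      using lsc d unfolding lower_semicontinuous_def eventually_nhds by blast
    have "open ((\<lambda>v. x + v) -` W)"
      using W(1) by (intro open_vimage continuous_on_add continuous_on_const continuous_on_id)
    then show ?thesis using W by (intro exI[of _ "(\<lambda>v. x + v) -` W"]) auto
  qed
  obtain W0 where W0: "open W0" "0 \<in> W0" "\<forall>v\<in>W0. ereal a < h (x0 + v)" using ev[OF a] by blast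
  have "ereal (b - 1) < h x1" using b by simp
  then obtain W1 where W1: "open W1" "0 \<in> W1" "\<forall>v\<in>W1. ereal (b - 1) < h (x1 + v)"
    using ev by blast
  obtain V where V: "open V" "convex V" "0 \<in> V" "V \<subseteq> W0 \<inter> W1" "\<And>v. v \<in> V \<Longrightarrow> - v \<in> V"
    using symmetric_convex_nhd[of "W0 \<inter> W1"] W0 W1 by auto
  obtain p where p: "sublinear p" "\<And>x. 0 \<le> p x" "\<And>x. p x < 1 \<Longrightarrow> x \<in> V" "\<And>x. x \<in> V \<Longrightarrow> p x \<le> 1"
    by (rule gauge_exists[OF V(2) open_nhd_absorbing[OF V(1,3)]]) (rule that)
  have growth: "ereal (b - 1 - p v) \<le> h (x1 + v)" for v
  proof -
    \<comment> \<open>Dividing \<open>v\<close> by \<open>\<rho>\<close> lands where \<open>h > b - 1\<close>; convexity along the segment to \<open>x1 + v\<close> does the rest.\<close>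
    define \<rho> where "\<rho> = p v + 1"
    have \<rho>: "\<rho> \<ge> 1" "p v < \<rho>" using p(2)[of v] by (auto simp: \<rho>_def)
    have "p ((1 / \<rho>) *\<^sub>R v) = (1 / \<rho>) * p v" using \<rho> by (intro sublinear_scaleR[OF p(1)]) auto
    also have "\<dots> < 1" using \<rho> by (simp add: field_simps)
    finally have "(1 / \<rho>) *\<^sub>R v \<in> W1" using p(3) V(4) by blast
    then have "ereal (b - 1) < h (x1 + (1 / \<rho>) *\<^sub>R v)" using W1(3) by blast
    also have "x1 + (1 / \<rho>) *\<^sub>R v = (1 - 1 / \<rho>) *\<^sub>R x1 + (1 / \<rho>) *\<^sub>R (x1 + v)"
      by (simp add: algebra_simps)
    also have "h \<dots> \<le> ereal (1 - 1 / \<rho>) * h x1 + ereal (1 / \<rho>) * h (x1 + v)"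
      using \<rho> by (intro ereal_convexD[OF conv]) auto
    finally have less: "ereal (b - 1) < ereal (1 - 1 / \<rho>) * h x1 + ereal (1 / \<rho>) * h (x1 + v)" .
    show ?thesis
    proof (cases "h (x1 + v)")
      case (real H)
      then have "b - 1 < (1 - 1 / \<rho>) * b + (1 / \<rho>) * H" using less b by simp
      then have "\<rho> * (b - 1) < \<rho> * ((1 - 1 / \<rho>) * b + (1 / \<rho>) * H)"
        using \<rho> by (intro mult_strict_left_mono) auto
      also have "\<dots> = (\<rho> - 1) * b + H" using \<rho> by (simp add: field_simps)
      finally have "b - \<rho> < H" by (simp add: algebra_simps)
      then show ?thesis using real by (simp add: \<rho>_def)
    qed (use not_MInf in auto)
  qed
  \<comment> \<open>The slope is chosen so that the growth bound wins as soon as \<open>p v \<ge> 1\<close>.\<close>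
  define n where "n = \<bar>a - b + 1 + p (x0 - x1)\<bar> + 1"
  have n: "n > 0" by (simp add: n_def add_nonneg_pos)
  have main: "ereal (a - n * p v) \<le> h (x0 + v)" for v
  proof (cases "p v < 1")
    case True
    then have "ereal a < h (x0 + v)" using p(3) V(4) W0(3) by blast
    moreover have "ereal (a - n * p v) \<le> ereal a" using n p(2)[of v] by simp
    ultimately show ?thesis by order
  next
    case False
    have "\<bar>a - b + 1 + p (x0 - x1)\<bar> * 1 \<le> \<bar>a - b + 1 + p (x0 - x1)\<bar> * p v"
      using False by (intro mult_left_mono) auto
    then have "a - n * p v \<le> b - 1 - (p (x0 - x1) + p v)"
      by (simp add: n_def algebra_simps)
    also have "\<dots> \<le> b - 1 - p (x0 - x1 + v)"
      using sublinear_add[OF p(1), of "x0 - x1" v] by simp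
    finally have "ereal (a - n * p v) \<le> ereal (b - 1 - p (x0 - x1 + v))" by simp
    also have "\<dots> \<le> h (x1 + (x0 - x1 + v))" by (rule growth)
    finally show ?thesis by simp
  qed
  define S where "S = {(v, c). h (x0 + v) \<le> ereal (c + a)}"
  have S: "convex S"
  proof (rule convexI)
    fix P Q and u w :: real
    assume PQ: "P \<in> S" "Q \<in> S" and uw: "0 \<le> u" "0 \<le> w" "u + w = 1"
    obtain v c v' c' where eq: "P = (v, c)" "Q = (v', c')" by (cases P, cases Q)
    have "x0 = u *\<^sub>R x0 + w *\<^sub>R x0" using uw(3) by (metis scaleR_add_left scaleR_one)
    then have "x0 + (u *\<^sub>R v + w *\<^sub>R v') = u *\<^sub>R (x0 + v) + w *\<^sub>R (x0 + v')"
      by (simp add: scaleR_add_right)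
    then have "h (x0 + (u *\<^sub>R v + w *\<^sub>R v')) \<le> ereal u * h (x0 + v) + ereal w * h (x0 + v')"
      using ereal_convexD[OF conv uw] by simp
    also have "\<dots> \<le> ereal u * ereal (c + a) + ereal w * ereal (c' + a)"
      using PQ uw by (intro add_mono ereal_mult_left_mono) (auto simp: S_def eq)
    also have "\<dots> = ereal (u * c + w * c' + (u + w) * a)" by (simp add: algebra_simps)
    finally show "u *\<^sub>R P + w *\<^sub>R Q \<in> S" by (simp add: S_def eq uw(3))
  qed
  have np: "sublinear (\<lambda>v. n * p v)"
    unfolding sublinear_def
  proof (intro conjI allI impI)
    show "n * p (x + y) \<le> n * p x + n * p y" for x y
      using mult_left_mono[OF sublinear_add[OF p(1), of x y], of n] n by (simp add: algebra_simps)
    show "n * p (t *\<^sub>R x) = t * (n * p x)" if "t > 0" for t x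
      using sublinear_scaleR[OF p(1), of t x] that by simp
  qed
  have nonneg: "0 \<le> n * p v + c" if "(v, c) \<in> S" for v c
  proof -
    have "ereal (a - n * p v) \<le> ereal (c + a)"
      using that by (intro order_trans[OF main[of v]]) (simp add: S_def)
    then show ?thesis by simp
  qed
  obtain \<phi> where \<phi>: "linear \<phi>" "\<And>x. \<phi> x \<le> n * p x" "\<And>v c. (v, c) \<in> S \<Longrightarrow> 0 \<le> \<phi> v + c"
    using mazur_orlicz[OF np S nonneg] by blast
  define y where "y x = - \<phi> x" for x
  have y_lin: "linear y" unfolding y_def by (intro linear_compose_neg \<phi>(1))
  have "\<bar>y v\<bar> \<le> n" if "v \<in> V" for v
  proof -
    have "n * p v \<le> n * 1" "n * p (- v) \<le> n * 1"
      using p(4) V(5) that n by (intro mult_left_mono; simp)+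
    then show ?thesis
      using \<phi>(2)[of v] \<phi>(2)[of "- v"] linear_neg[OF \<phi>(1), of v] by (simp add: y_def)
  qed
  then have "y \<in> topological_dual" by (rule linear_bounded_on_nhd_continuous[OF y_lin V(1,3)])
  moreover have "ereal (y x - (y x0 - a)) \<le> h x" for x
  proof (cases "h x")
    case (real H)
    then have "(x - x0, H - a) \<in> S" by (simp add: S_def)
    from \<phi>(3)[OF this] show ?thesis using real by (simp add: y_def linear_diff[OF \<phi>(1)])
  qed (use not_MInf in auto)
  ultimately show thesis by (rule that) simp
qed

text \<open>Unlike membership in \<open>\<Gamma>(X)\<close>, this does not ask for a nonempty domain: the sum of two functions in \<open>\<Gamma>(X)\<close>
  may be identically \<open>\<infinity>\<close>, and dropping properness makes the class closed under addition.\<close>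

definition closed_convex :: "('a::locally_convex_t2_space \<Rightarrow> ereal) \<Rightarrow> bool" where
  "closed_convex h \<longleftrightarrow> lower_semicontinuous h \<and> ereal_convex h \<and> (\<forall>x. h x \<noteq> -\<infinity>)"

lemma closed_convexD:
  assumes "closed_convex h"
  shows "lower_semicontinuous h" "ereal_convex h" "h x \<noteq> -\<infinity>"
  using assms by (auto simp: closed_convex_def)

lemma Gamma_class_closed_convex: "h \<in> Gamma_class \<Longrightarrow> closed_convex h"
  by (simp add: Gamma_class_def closed_convex_def proper_def)

text \<open>Splitting a strict lower bound of a sum into strict lower bounds of the summands reduces lower semicontinuity
  of a sum to that of the summands. An infinite summand leaves room for any choice in the other.\<close>

lemma ereal_less_add_split:
  fixes a u v :: ereal
  assumes "a < u + v" "u \<noteq> -\<infinity>" "v \<noteq> -\<infinity>"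
  obtains b c :: real where "ereal b < u" "ereal c < v" "a \<le> ereal (b + c)"
proof -
  obtain b0 where b0: "ereal b0 < u" using ereal_dense2[of "-\<infinity>" u] assms by auto
  obtain c0 where c0: "ereal c0 < v" using ereal_dense2[of "-\<infinity>" v] assms by auto
  show thesis
  proof (cases a)
    case (real r)
    show thesis
    proof (cases "u = \<infinity> \<or> v = \<infinity>")
      case True
      then show thesis
      proof
        assume "u = \<infinity>"
        then show thesis using c0 real by (intro that[of "r - c0" c0]) auto
      next
        assume "v = \<infinity>"
        then show thesis using b0 real by (intro that[of b0 "r - b0"]) auto
      qed
    next
      case False
      then obtain U V where UV: "u = ereal U" "v = ereal V" using assms by (cases u; cases v; auto)
      show thesis
        using assms(1) UV real
        by (intro that[of "U - (U + V - r) / 2" "V - (U + V - r) / 2"]) (auto simp: field_simps)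
    qed
  next
    case PInf then show thesis using assms by auto
  next
    case MInf then show thesis using b0 c0 by (intro that[of b0 c0]) auto
  qed
qed

lemma lower_semicontinuous_add:
  fixes h k :: "'a::topological_space \<Rightarrow> ereal"
  assumes "lower_semicontinuous h" "lower_semicontinuous k"
    and "\<And>x. h x \<noteq> -\<infinity>" "\<And>x. k x \<noteq> -\<infinity>"
  shows "lower_semicontinuous (\<lambda>x. h x + k x)"
  unfolding lower_semicontinuous_def
proof (intro allI impI)
  fix x a assume "a < h x + k x"
  then obtain b c where bc: "ereal b < h x" "ereal c < k x" "a \<le> ereal (b + c)"
    using ereal_less_add_split assms(3,4) by metis
  have "\<forall>\<^sub>F y in nhds x. ereal b < h y \<and> ereal c < k y"
    using assms(1,2) bc unfolding lower_semicontinuous_def by (intro eventually_conj) auto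
  then show "\<forall>\<^sub>F y in nhds x. a < h y + k y"
  proof (rule eventually_mono)
    fix y assume "ereal b < h y \<and> ereal c < k y"
    then have "ereal b + ereal c < h y + k y" by (intro ereal_add_strict_mono2) auto
    then show "a < h y + k y" using bc(3) by auto
  qed
qed

lemma ereal_less_scale_iff:
  "l > 0 \<Longrightarrow> ereal r < ereal l * u \<longleftrightarrow> ereal (r / l) < u"
  by (cases u) (auto simp: field_simps)

lemma closed_convex_scale:
  assumes h: "closed_convex h" and l: "l > 0"
  shows "closed_convex (\<lambda>x. ereal l * h x)"
proof -
  have nm: "ereal l * h x \<noteq> -\<infinity>" for x
    using closed_convexD(3)[OF h, of x] l by (cases "h x") auto
  have "lower_semicontinuous (\<lambda>x. ereal l * h x)"
    unfolding lower_semicontinuous_def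
  proof (intro allI impI)
    fix x a assume a: "a < ereal l * h x"
    show "\<forall>\<^sub>F y in nhds x. a < ereal l * h y"
    proof (cases a)
      case (real r)
      then show ?thesis
        using a closed_convexD(1)[OF h] l by (simp add: ereal_less_scale_iff lower_semicontinuous_def)
    next
      case PInf then show ?thesis using a by simp
    next
      case MInf then show ?thesis using nm by simp
    qed
  qed
  moreover have "ereal_convex (\<lambda>x. ereal l * h x)"
    unfolding ereal_convex_def
  proof (intro allI impI)
    fix x y and u v :: real assume uv: "0 \<le> u" "0 \<le> v" "u + v = 1"
    have "ereal l * h (u *\<^sub>R x + v *\<^sub>R y) \<le> ereal l * (ereal u * h x + ereal v * h y)"
      using l by (intro ereal_mult_left_mono ereal_convexD[OF closed_convexD(2)[OF h] uv]) auto
    also have "\<dots> = ereal u * (ereal l * h x) + ereal v * (ereal l * h y)"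
      using l by (simp add: ereal_pos_distrib ac_simps)
    finally show "ereal l * h (u *\<^sub>R x + v *\<^sub>R y)
      \<le> ereal u * (ereal l * h x) + ereal v * (ereal l * h y)" .
  qed
  ultimately show ?thesis using nm by (simp add: closed_convex_def)
qed

lemma closed_convex_add:
  assumes h: "closed_convex h" and k: "closed_convex k"
  shows "closed_convex (\<lambda>x. h x + k x)"
proof -
  have "ereal_convex (\<lambda>x. h x + k x)"
    unfolding ereal_convex_def
  proof (intro allI impI)
    fix x y and u v :: real assume uv: "0 \<le> u" "0 \<le> v" "u + v = 1"
    have "h (u *\<^sub>R x + v *\<^sub>R y) + k (u *\<^sub>R x + v *\<^sub>R y)
        \<le> (ereal u * h x + ereal v * h y) + (ereal u * k x + ereal v * k y)"
      by (intro add_mono ereal_convexD[OF closed_convexD(2)[OF h] uv]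
          ereal_convexD[OF closed_convexD(2)[OF k] uv])
    also have "\<dots> = ereal u * (h x + k x) + ereal v * (h y + k y)"
      using uv by (simp add: ereal_pos_distrib ac_simps)
    finally show "h (u *\<^sub>R x + v *\<^sub>R y) + k (u *\<^sub>R x + v *\<^sub>R y)
        \<le> ereal u * (h x + k x) + ereal v * (h y + k y)" .
  qed
  moreover have "lower_semicontinuous (\<lambda>x. h x + k x)"
    by (intro lower_semicontinuous_add closed_convexD[OF h] closed_convexD[OF k])
  ultimately show ?thesis
    using closed_convexD(3)[OF h] closed_convexD(3)[OF k] by (simp add: closed_convex_def)
qed

section \<open>Lagrangians\<close>

definition lagrangian ::
    "('a \<Rightarrow> ereal) \<Rightarrow> (nat \<Rightarrow> 'a \<Rightarrow> ereal) \<Rightarrow> (nat \<Rightarrow> real) \<Rightarrow> 'a \<Rightarrow> ereal" where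
  "lagrangian f g l x = f x + (\<Sum>k | l k \<noteq> 0. ereal (l k) * g k x)"

text \<open>Since \<open>0 * \<infinity> = 0\<close>, the sum may range over any finite set that contains the support.\<close>

lemma lagrangian_superset:
  assumes "finite K" "{k. l k \<noteq> 0} \<subseteq> K"
  shows "lagrangian f g l x = f x + (\<Sum>k\<in>K. ereal (l k) * g k x)"
  unfolding lagrangian_def using assms
  by (intro arg_cong2[of _ _ _ _ "(+)"] refl sum.mono_neutral_left) (auto simp: zero_ereal_def[symmetric])

lemma closed_convex_lagrangian:
  assumes f: "closed_convex f" and g: "\<And>k. k \<ge> 1 \<Longrightarrow> closed_convex (g k)"
    and l: "l \<in> nonneg_finsupp"
  shows "closed_convex (lagrangian f g l)"
proof -
  have "closed_convex (\<lambda>x. f x + (\<Sum>k\<in>K. ereal (l k) * g k x))"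
    if "finite K" "K \<subseteq> {k. l k \<noteq> 0}" for K
    using that
  proof (induction K)
    case empty
    then show ?case using f by simp
  next
    case (insert k K)
    have "k \<ge> 1" "l k > 0"
      using insert.prems l by (auto simp: nonneg_finsupp_def order_less_le)
    moreover have "closed_convex (\<lambda>x. f x + (\<Sum>k\<in>K. ereal (l k) * g k x))"
      using insert by simp
    ultimately have "closed_convex (\<lambda>x. (f x + (\<Sum>k\<in>K. ereal (l k) * g k x)) + ereal (l k) * g k x)"
      using closed_convex_add closed_convex_scale g by blast
    then show ?case using insert.hyps by (simp add: ac_simps)
  qed
  then show ?thesis
    using l unfolding lagrangian_def by (simp add: nonneg_finsupp_def)
qed

text \<open>Where a Lagrangian is finite, all its terms are real numbers, so that identities between Lagrangians can be
  checked in \<open>\<real>\<close>.\<close>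

lemma lagrangian_finite_values:
  assumes f: "closed_convex f" and g: "\<And>k. k \<ge> 1 \<Longrightarrow> closed_convex (g k)"
    and l: "l \<in> nonneg_finsupp" and fin: "lagrangian f g l x \<noteq> \<infinity>"
  shows "\<bar>f x\<bar> \<noteq> \<infinity>" "l k \<noteq> 0 \<Longrightarrow> \<bar>g k x\<bar> \<noteq> \<infinity>"
proof -
  have fx: "f x \<noteq> -\<infinity>" using f by (rule closed_convexD)
  have "f x \<noteq> \<infinity>" and sm: "(\<Sum>k | l k \<noteq> 0. ereal (l k) * g k x) \<noteq> \<infinity>"
    using fin by (auto simp: lagrangian_def)
  with fx show "\<bar>f x\<bar> \<noteq> \<infinity>" by auto
  assume k: "l k \<noteq> 0"
  then have "l k > 0" "k \<ge> 1" using l by (auto simp: nonneg_finsupp_def order_less_le)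
  moreover have "g k x \<noteq> -\<infinity>" using g[OF \<open>k \<ge> 1\<close>] by (rule closed_convexD)
  moreover have "ereal (l k) * g k x \<noteq> \<infinity>"
    using sm k l by (auto simp: sum_Pinfty nonneg_finsupp_def)
  ultimately show "\<bar>g k x\<bar> \<noteq> \<infinity>" by auto
qed

lemma lagrangian_le:
  assumes "l \<in> nonneg_finsupp" "x \<in> feasible_set g"
  shows "lagrangian f g l x \<le> f x"
proof -
  have "(\<Sum>k | l k \<noteq> 0. ereal (l k) * g k x) \<le> 0"
  proof (rule sum_nonpos)
    fix k assume "k \<in> {k. l k \<noteq> 0}"
    then have "g k x \<le> 0" "0 \<le> l k" using assms by (auto simp: feasible_set_def nonneg_finsupp_def)
    then have "ereal (l k) * g k x \<le> ereal (l k) * 0" by (intro ereal_mult_left_mono) auto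
    then show "ereal (l k) * g k x \<le> 0" by simp
  qed
  then show ?thesis unfolding lagrangian_def using add_left_mono[of _ 0 "f x"] by simp
qed

lemma lagrangian_le_constrained:
  assumes "l \<in> nonneg_finsupp" "f x \<noteq> -\<infinity>"
  shows "lagrangian f g l x \<le> f x + delta (feasible_set g) x"
  using lagrangian_le[OF assms(1), of x g f] assms(2) by (auto simp: delta_def)

text \<open>The supremum of all Lagrangians is \<open>f + \<delta>\<^sub>E\<close>: at a point that violates the constraint \<open>k\<close>, a large
  multiplier of \<open>g k\<close> alone makes the Lagrangian exceed any bound.\<close>

lemma constrained_le_sup_lagrangian:
  assumes f: "f x \<noteq> -\<infinity>" and le: "\<And>l. l \<in> nonneg_finsupp \<Longrightarrow> lagrangian f g l x \<le> ereal \<gamma>"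
  shows "f x + delta (feasible_set g) x \<le> ereal \<gamma>"
proof -
  have "lagrangian f g (\<lambda>_. 0) x \<le> ereal \<gamma>" by (rule le) (simp add: nonneg_finsupp_def)
  then have f_le: "f x \<le> ereal \<gamma>" by (simp add: lagrangian_def)
  then obtain F where F: "f x = ereal F" using f by (cases "f x") auto
  have "x \<in> feasible_set g"
  proof (rule ccontr)
    assume "x \<notin> feasible_set g"
    then obtain k where k: "k \<ge> 1" "g k x > 0" by (auto simp: feasible_set_def not_le)
    have single: "ereal F + ereal t * g k x \<le> ereal \<gamma>" if "t > 0" for t
    proof -
      have "lagrangian f g (\<lambda>j. if j = k then t else 0) x \<le> ereal \<gamma>"
        using k that by (intro le) (auto simp: nonneg_finsupp_def)
      then show ?thesis
        using that F by (subst (asm) lagrangian_superset[of "{k}"]) auto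
    qed
    show False
    proof (cases "g k x")
      case (real G)
      then have G: "G > 0" using k by simp
      define t where "t = (\<bar>\<gamma> - F\<bar> + 1) / G"
      have "t > 0" using G by (simp add: t_def add_nonneg_pos)
      from single[OF this] have "F + t * G \<le> \<gamma>" using real by simp
      moreover have "t * G = \<bar>\<gamma> - F\<bar> + 1" using G by (simp add: t_def)
      ultimately show False by linarith
    qed (use k single[of 1] in auto)
  qed
  then show ?thesis using f_le by (simp add: delta_def)
qed

text \<open>Points of the epigraph of a conjugate are the affine minorants of the function. In this form no subtraction of
  infinite values occurs.\<close>

lemma conjugate_le_iff: "conjugate h y \<le> ereal s \<longleftrightarrow> (\<forall>x. ereal (y x - s) \<le> h x)"
proof -
  have "ereal (y x) - h x \<le> ereal s \<longleftrightarrow> ereal (y x - s) \<le> h x" for x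
    by (cases "h x") auto
  then show ?thesis by (simp add: conjugate_def SUP_le_iff)
qed

section \<open>Affine minorants of Lagrangians\<close>

lemma mem_epi_union:
  "(y, s) \<in> epi_union f g \<longleftrightarrow>
    y \<in> topological_dual \<and> (\<exists>l\<in>nonneg_finsupp. \<forall>x. ereal (y x - s) \<le> lagrangian f g l x)"
  by (auto simp: epi_union_def epi_conjugate_def conjugate_le_iff lagrangian_def)

lemma topological_dual_combination:
  assumes "y \<in> topological_dual" "z \<in> topological_dual"
  shows "(\<lambda>x. u * y x + v * z x) \<in> topological_dual"
  using assms unfolding topological_dual_def
  by (auto intro!: linear_compose_add linear_compose_scale_right[where 'b=real, simplified] continuous_intros)

text \<open>The Lagrangian is affine in the multiplier, so the combination of two minorants is a minorant of the Lagrangian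
  of the combined multiplier. Where that Lagrangian is infinite nothing is to be shown; elsewhere all terms
  with a nonzero coefficient in either multiplier are real, as both weights may be taken positive.\<close>

lemma epi_union_convex:
  assumes f: "closed_convex f" and g: "\<And>k. k \<ge> 1 \<Longrightarrow> closed_convex (g k)"
    and mem: "(y, r) \<in> epi_union f g" "(z, s) \<in> epi_union f g"
    and uv: "0 \<le> u" "0 \<le> v" "u + v = 1"
  shows "(\<lambda>x. u * y x + v * z x, u * r + v * s) \<in> epi_union f g"
proof (cases "u = 0 \<or> v = 0")
  case True
  then show ?thesis using uv mem by (elim disjE) auto
next
  case False
  with uv have pos: "0 < u" "0 < v" by auto
  obtain l where l: "l \<in> nonneg_finsupp" "\<And>x. ereal (y x - r) \<le> lagrangian f g l x"
    using mem(1) by (auto simp: mem_epi_union)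
  obtain m where m: "m \<in> nonneg_finsupp" "\<And>x. ereal (z x - s) \<le> lagrangian f g m x"
    using mem(2) by (auto simp: mem_epi_union)
  define n where "n k = u * l k + v * m k" for k
  have "n k = 0 \<longleftrightarrow> l k = 0 \<and> m k = 0" for k
    using l(1) m(1) pos by (auto simp: n_def nonneg_finsupp_def add_nonneg_eq_0_iff)
  then have supp: "{k. n k \<noteq> 0} = {k. l k \<noteq> 0} \<union> {k. m k \<noteq> 0}" by auto
  have n: "n \<in> nonneg_finsupp"
    using l(1) m(1) uv supp unfolding nonneg_finsupp_def by (auto simp: n_def)
  have "ereal ((u * y x + v * z x) - (u * r + v * s)) \<le> lagrangian f g n x" for x
  proof (cases "lagrangian f g n x = \<infinity>")
    case False
    define K where "K = {k. n k \<noteq> 0}"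
    have K: "finite K" "{k. l k \<noteq> 0} \<subseteq> K" "{k. m k \<noteq> 0} \<subseteq> K" "{k. n k \<noteq> 0} \<subseteq> K"
      using n supp by (auto simp: K_def nonneg_finsupp_def)
    define F where "F = real_of_ereal (f x)"
    define G where "G k = real_of_ereal (g k x)" for k
    have fin: "f x = ereal F" "\<And>k. k \<in> K \<Longrightarrow> g k x = ereal (G k)"
      using lagrangian_finite_values[OF f g n False]
      by (auto simp: F_def G_def K_def ereal_real')
    have val: "lagrangian f g j x = ereal (F + (\<Sum>k\<in>K. j k * G k))" if "{k. j k \<noteq> 0} \<subseteq> K" for j
      by (simp add: lagrangian_superset[OF K(1) that] fin)
    have "y x - r \<le> F + (\<Sum>k\<in>K. l k * G k)" "z x - s \<le> F + (\<Sum>k\<in>K. m k * G k)"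
      using l(2)[of x] m(2)[of x] K by (auto simp: val)
    then have "u * (y x - r) + v * (z x - s)
        \<le> u * (F + (\<Sum>k\<in>K. l k * G k)) + v * (F + (\<Sum>k\<in>K. m k * G k))"
      using uv by (intro add_mono mult_left_mono) auto
    also have "\<dots> = (u + v) * F + (\<Sum>k\<in>K. n k * G k)"
      by (simp add: n_def algebra_simps sum.distrib sum_distrib_left)
    finally have "u * (y x - r) + v * (z x - s) \<le> F + (\<Sum>k\<in>K. n k * G k)" using uv by simp
    then show ?thesis using K by (simp add: val algebra_simps)
  qed simp
  moreover have "(\<lambda>x. u * y x + v * z x) \<in> topological_dual"
    using mem by (intro topological_dual_combination) (auto simp: mem_epi_union)
  ultimately show ?thesis using n by (auto simp: mem_epi_union)
qed

text \<open>Fenchel-Moreau for \<open>f + \<delta>\<^sub>E\<close>: each Lagrangian is the supremum of its continuous affine minorants, since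
  it is finite at \<open>x1\<close>, and \<open>f + \<delta>\<^sub>E\<close> is the supremum of the Lagrangians.\<close>

lemma constrained_le_sup_affine:
  assumes f: "closed_convex f" and g: "\<And>k. k \<ge> 1 \<Longrightarrow> closed_convex (g k)"
    and x1: "x1 \<in> feasible_set g" "f x1 < \<infinity>"
    and le: "\<And>y s. (y, s) \<in> epi_union f g \<Longrightarrow> y w - s \<le> \<gamma>"
  shows "f w + delta (feasible_set g) w \<le> ereal \<gamma>"
proof (rule constrained_le_sup_lagrangian)
  show "f w \<noteq> -\<infinity>" using f by (rule closed_convexD)
next
  fix l assume l: "l \<in> nonneg_finsupp"
  have L: "closed_convex (lagrangian f g l)"
    by (rule closed_convex_lagrangian[OF f g l])
  show "lagrangian f g l w \<le> ereal \<gamma>"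
  proof (rule ccontr)
    assume "\<not> ?thesis"
    then obtain a where a: "\<gamma> < a" "ereal a < lagrangian f g l w"
      using ereal_dense2[of "ereal \<gamma>" "lagrangian f g l w"] by (auto simp: not_le)
    have fin: "lagrangian f g l x1 < \<infinity>" using lagrangian_le[OF l x1(1), of f] x1(2) by order
    obtain y s where ys: "y \<in> topological_dual" "\<And>x. ereal (y x - s) \<le> lagrangian f g l x" "a \<le> y w - s"
      by (rule affine_minorant[OF closed_convexD[OF L] fin a(2)]) (rule that)
    then have "(y, s) \<in> epi_union f g" using l by (auto simp: mem_epi_union)
    from le[OF this] show False using ys(3) a(1) by linarith
  qed
qed

section \<open>The weak* closure of the union of epigraphs\<close>

lemma weak_star_box_nhd:
  assumes "openin (prod_topology weak_star euclideanreal) T" "(y0, r) \<in> T"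
  obtains F \<epsilon> where "finite F" "\<epsilon> > 0"
    "\<And>y s. y \<in> topological_dual \<Longrightarrow> (\<And>i. i \<in> F \<Longrightarrow> \<bar>y i - y0 i\<bar> < \<epsilon>) \<Longrightarrow> \<bar>s - r\<bar> < \<epsilon> \<Longrightarrow> (y, s) \<in> T"
proof -
  obtain U W where UW: "openin weak_star U" "open W" "y0 \<in> U" "r \<in> W" "U \<times> W \<subseteq> T"
    using assms unfolding openin_prod_topology_alt by (metis open_openin)
  obtain P where P: "openin (product_topology (\<lambda>_. euclideanreal) UNIV) P" "U = P \<inter> topological_dual"
    using UW(1) unfolding weak_star_def openin_subtopology by blast
  have "y0 \<in> P" using UW(3) P(2) by blast
  from product_topology_open_contains_basis[OF P(1) this]
  obtain X where X: "y0 \<in> Pi\<^sub>E UNIV X" "\<forall>i. openin euclideanreal (X i)"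
    "finite {i. X i \<noteq> topspace euclideanreal}" "Pi\<^sub>E UNIV X \<subseteq> P"
    by (elim exE conjE) (rule that)
  define F where "F = {i. X i \<noteq> UNIV}"
  have "\<exists>e>0. ball (y0 i) e \<subseteq> X i" for i
    using X(1,2) by (simp add: PiE_UNIV_domain open_contains_ball Pi_iff)
  then obtain e where e: "\<And>i. e i > 0" "\<And>i. ball (y0 i) (e i) \<subseteq> X i" by metis
  obtain e0 where e0: "e0 > 0" "ball r e0 \<subseteq> W" using UW(2,4) by (auto simp: open_contains_ball)
  define \<epsilon> where "\<epsilon> = Min (insert e0 (e ` F))"
  have fin: "finite F" using X(3) by (simp add: F_def)
  have "\<epsilon> > 0" using fin e(1) e0(1) by (simp add: \<epsilon>_def)
  have eps: "\<epsilon> \<le> e0" "\<And>i. i \<in> F \<Longrightarrow> \<epsilon> \<le> e i" using fin by (auto simp: \<epsilon>_def)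
  show thesis
  proof (rule that[OF fin \<open>\<epsilon> > 0\<close>])
    fix y s assume y: "y \<in> topological_dual" "\<And>i. i \<in> F \<Longrightarrow> \<bar>y i - y0 i\<bar> < \<epsilon>" and s: "\<bar>s - r\<bar> < \<epsilon>"
    have "y i \<in> X i" for i
    proof (cases "i \<in> F")
      case True
      then have "y i \<in> ball (y0 i) (e i)"
        using y(2)[OF True] eps(2)[OF True] by (simp add: dist_real_def abs_minus_commute)
      then show ?thesis using e(2) by blast
    qed (simp add: F_def)
    then have "y \<in> U" using X(4) P(2) y(1) by (auto simp: PiE_UNIV_domain)
    moreover have "s \<in> W" using s eps(1) e0(2) by (auto simp: dist_real_def subset_iff)
    ultimately show "(y, s) \<in> T" using UW(5) by blast
  qed
qed

lemma topspace_weak_star: "topspace weak_star = topological_dual"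
  by (simp add: weak_star_def)

text \<open>Weak duality puts \<open>epi_union f g\<close> into each half-space \<open>{(y, s). y x - s \<le> c}\<close> with
  \<open>c = f x + \<delta>\<^sub>E x\<close> finite, and these are weak*-closed because evaluation at \<open>x\<close> is continuous.\<close>

lemma closure_epi_union_sound:
  assumes f: "closed_convex f"
    and mem: "(y, r) \<in> prod_topology weak_star euclideanreal closure_of (epi_union f g)"
  shows "y \<in> topological_dual" "ereal (y x - r) \<le> f x + delta (feasible_set g) x"
proof -
  let ?P = "prod_topology weak_star euclideanreal"
  show "y \<in> topological_dual"
    using mem closure_of_subset_topspace[of ?P "epi_union f g"] by (auto simp: topspace_weak_star)
  have nm: "f x \<noteq> -\<infinity>" using f by (rule closed_convexD)
  show "ereal (y x - r) \<le> f x + delta (feasible_set g) x"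
  proof (cases "f x + delta (feasible_set g) x")
    case (real c)
    have "continuous_map ?P euclideanreal ((\<lambda>y. y x) \<circ> fst)"
      unfolding weak_star_def
      by (intro continuous_map_compose[OF continuous_map_fst] continuous_map_from_subtopology
          continuous_map_product_projection) simp
    then have cont: "continuous_map ?P euclideanreal (\<lambda>p. fst p x - snd p)"
      by (intro continuous_map_diff continuous_map_snd) (simp add: comp_def)
    have cl: "closedin ?P {p \<in> topspace ?P. fst p x - snd p \<in> {..c}}"
      by (rule closedin_continuous_map_preimage[OF cont]) simp
    have "epi_union f g \<subseteq> {p \<in> topspace ?P. fst p x - snd p \<in> {..c}}"
    proof (clarify)
      fix z s assume zs: "(z, s) \<in> epi_union f g"
      then obtain l where l: "l \<in> nonneg_finsupp" "ereal (z x - s) \<le> lagrangian f g l x"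
        and z: "z \<in> topological_dual"
        by (auto simp: mem_epi_union)
      have "ereal (z x - s) \<le> ereal c"
        using l(2) lagrangian_le_constrained[OF l(1), of f x] nm real by (metis order_trans)
      then show "(z, s) \<in> topspace ?P \<and> fst (z, s) x - snd (z, s) \<in> {..c}"
        using z by (simp add: topspace_weak_star)
    qed
    from closure_of_minimal[OF this cl] mem have "y x - r \<le> c" by auto
    then show ?thesis using real by simp
  next
    case MInf
    then show ?thesis using nm by (auto simp: delta_def split: if_splits)
  next
    case PInf
    show ?thesis unfolding PInf by simp
  qed
qed

lemma abs_lookup_le_norm: "\<bar>Poly_Mapping.lookup w i\<bar> \<le> norm (w :: 'b \<Rightarrow>\<^sub>0 real)"
proof (cases "i \<in> Poly_Mapping.keys w")
  case True
  then have "\<bar>Poly_Mapping.lookup w i\<bar> \<le> (\<Sum>n\<in>Poly_Mapping.keys w. \<bar>Poly_Mapping.lookup w n\<bar>)"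
    by (intro member_le_sum) auto
  then show ?thesis by (simp add: norm_poly_mapping_def dist_poly_mapping_def)
qed (simp add: in_keys_iff)

lemma sublinear_norm: "sublinear norm"
  by (simp add: sublinear_def norm_triangle_ineq)

text \<open>If \<open>A\<close> misses a basic weak* neighbourhood of \<open>(y0, r)\<close>, it is separated from \<open>(y0, r)\<close> by evaluation at a
  point and a multiple of the real coordinate. Only the values on the finite set \<open>F\<close> matter, so the argument takes place in the normed space of finitely
  supported functions. There \<open>A\<close> becomes a convex set at distance at least \<open>\<epsilon>\<close> from the origin, and Mazur-Orlicz
  with the norm gives a linear functional that is at least \<open>\<epsilon>\<close> on it. Its coefficients at the points of \<open>F\<close> are
  the weights of the point \<open>z\<close>.\<close>

lemma weak_star_separation:
  fixes A :: "(('a::real_vector \<Rightarrow> real) \<times> real) set"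
  assumes conv: "\<And>y s z t u v. (y, s) \<in> A \<Longrightarrow> (z, t) \<in> A \<Longrightarrow> 0 \<le> u \<Longrightarrow> 0 \<le> v \<Longrightarrow> u + v = 1 \<Longrightarrow>
      (\<lambda>x. u * y x + v * z x, u * s + v * t) \<in> A"
    and lin: "\<And>y s. (y, s) \<in> A \<Longrightarrow> linear y" "linear y0"
    and F: "finite F"
    and far: "\<And>y s. (y, s) \<in> A \<Longrightarrow> (\<And>i. i \<in> F \<Longrightarrow> \<bar>y i - y0 i\<bar> < \<epsilon>) \<Longrightarrow> \<not> \<bar>s - r\<bar> < \<epsilon>"
  shows "\<exists>z \<tau>. \<forall>(y, s)\<in>A. y z - \<tau> * s \<le> y0 z - \<tau> * r - \<epsilon>"
proof -
  define J :: "('a \<Rightarrow> real) \<Rightarrow> ('a \<Rightarrow>\<^sub>0 real)" where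
    "J y = (\<Sum>i\<in>F. (y i - y0 i) *\<^sub>R Poly_Mapping.single i 1)" for y
  define S where "S = {((J y, s - r), - \<epsilon>) | y s. (y, s) \<in> A}"
  have lookup_scaleR: "Poly_Mapping.lookup (c *\<^sub>R w) i = c * Poly_Mapping.lookup w i"
    for c i and w :: "'a \<Rightarrow>\<^sub>0 real"
    by (simp add: scaleR_poly_mapping_def Abs_poly_mapping_inverse)
  have lookup_J: "Poly_Mapping.lookup (J y) i = y i - y0 i" if "i \<in> F" for y i
    using that F by (simp add: J_def lookup_sum lookup_scaleR lookup_single when_def if_distrib cong: if_cong)
  have J_comb: "J (\<lambda>x. u * y x + v * z x) = u *\<^sub>R J y + v *\<^sub>R J z" if "u + v = 1" for u v y z
  proof -
    have v: "v = 1 - u" using that by simp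
    show ?thesis
      unfolding J_def scaleR_sum_right sum.distrib[symmetric] scaleR_scaleR scaleR_add_left[symmetric]
      by (simp add: v algebra_simps)
  qed
  have S: "convex S"
  proof (rule convexI)
    fix P Q and u v :: real
    assume PQ: "P \<in> S" "Q \<in> S" and uv: "0 \<le> u" "0 \<le> v" "u + v = 1"
    obtain y s z t where P: "P = ((J y, s - r), - \<epsilon>)" "(y, s) \<in> A"
      and Q: "Q = ((J z, t - r), - \<epsilon>)" "(z, t) \<in> A"
      using PQ by (auto simp: S_def)
    have v: "v = 1 - u" using uv by simp
    have "u *\<^sub>R P + v *\<^sub>R Q = ((J (\<lambda>x. u * y x + v * z x), (u * s + v * t) - r), - \<epsilon>)"
      using J_comb[OF uv(3), of y z] by (simp add: P Q v algebra_simps)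
    then show "u *\<^sub>R P + v *\<^sub>R Q \<in> S" using conv[OF P(2) Q(2) uv] by (auto simp: S_def)
  qed
  have nonneg: "0 \<le> norm w + c" if wc: "(w, c) \<in> S" for w c
  proof -
    obtain y s where w: "w = (J y, s - r)" "c = - \<epsilon>" "(y, s) \<in> A" using wc by (auto simp: S_def)
    have "\<not> norm w < \<epsilon>"
    proof
      assume less: "norm w < \<epsilon>"
      have "\<bar>y i - y0 i\<bar> < \<epsilon>" if "i \<in> F" for i
        using abs_lookup_le_norm[of "J y" i] norm_fst_le[of "J y" "s - r"] less
        by (simp add: lookup_J[OF that] w)
      moreover have "\<bar>s - r\<bar> < \<epsilon>" using norm_snd_le[of "s - r" "J y"] less by (simp add: w)
      ultimately show False using far[OF w(3)] by blast
    qed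
    then show ?thesis using w by simp
  qed
  obtain \<phi> where \<phi>: "linear \<phi>" "\<And>w c. (w, c) \<in> S \<Longrightarrow> 0 \<le> \<phi> w + c"
    using mazur_orlicz[OF sublinear_norm S nonneg] by blast
  define c where "c i = \<phi> (Poly_Mapping.single i 1, 0)" for i
  define \<tau> where "\<tau> = \<phi> (0, 1)"
  define z where "z = - (\<Sum>i\<in>F. c i *\<^sub>R i)"
  have lin_z: "y z = - (\<Sum>i\<in>F. c i * y i)" if "linear y" for y
    using that by (simp add: z_def linear_neg linear_sum linear_scale)
  have "\<forall>(y, s)\<in>A. y z - \<tau> * s \<le> y0 z - \<tau> * r - \<epsilon>"
  proof clarify
    fix y s assume ys: "(y, s) \<in> A"
    have "(J y, s - r) = (\<Sum>i\<in>F. (y i - y0 i) *\<^sub>R (Poly_Mapping.single i 1, 0)) + (s - r) *\<^sub>R (0, 1)"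
      by (simp add: J_def prod_eq_iff fst_sum snd_sum)
    then have "\<phi> (J y, s - r) = (\<Sum>i\<in>F. (y i - y0 i) * c i) + (s - r) * \<tau>"
      by (simp only: linear_add[OF \<phi>(1)] linear_sum[OF \<phi>(1)] linear_scale[OF \<phi>(1)] c_def \<tau>_def real_scaleR_def)
    also have "(\<Sum>i\<in>F. (y i - y0 i) * c i) = y0 z - y z"
      by (simp add: lin_z[OF lin(1)[OF ys]] lin_z[OF lin(2)] algebra_simps sum_subtractf)
    finally have "\<phi> (J y, s - r) = y0 z - y z + (s - r) * \<tau>" .
    moreover have "0 \<le> \<phi> (J y, s - r) - \<epsilon>" using \<phi>(2)[of "(J y, s - r)" "- \<epsilon>"] ys by (auto simp: S_def)
    ultimately show "y z - \<tau> * s \<le> y0 z - \<tau> * r - \<epsilon>" by (simp add: algebra_simps)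
  qed
  then show ?thesis by blast
qed

text \<open>A separating pair \<open>(z, \<tau>)\<close> may be vertical, that is \<open>\<tau> = 0\<close>. Adding \<open>\<delta>\<close> times the inequality
  \<open>y x1 - s \<le> f x1\<close>, valid on \<open>epi_union f g\<close>, makes the coefficient of \<open>s\<close> positive, and a small \<open>\<delta>\<close>
  preserves the gap \<open>\<epsilon>\<close>.\<close>

lemma closure_epi_union_complete:
  assumes f: "closed_convex f" and g: "\<And>k. k \<ge> 1 \<Longrightarrow> closed_convex (g k)"
    and x1: "x1 \<in> feasible_set g" "f x1 < \<infinity>"
    and xs: "xs \<in> topological_dual"
    and le: "\<And>x. ereal (xs x - r) \<le> f x + delta (feasible_set g) x"
  shows "(xs, r) \<in> prod_topology weak_star euclideanreal closure_of (epi_union f g)"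
proof (rule ccontr)
  let ?A = "epi_union f g"
  assume "\<not> ?thesis"
  moreover have "(xs, r) \<in> topspace (prod_topology weak_star euclideanreal)"
    using xs by (simp add: topspace_weak_star)
  ultimately obtain T where T: "openin (prod_topology weak_star euclideanreal) T" "(xs, r) \<in> T" "?A \<inter> T = {}"
    unfolding in_closure_of by blast
  obtain F \<epsilon> where F: "finite F" and \<epsilon>: "\<epsilon> > 0" and box:
    "\<And>y s. y \<in> topological_dual \<Longrightarrow> (\<And>i. i \<in> F \<Longrightarrow> \<bar>y i - xs i\<bar> < \<epsilon>) \<Longrightarrow> \<bar>s - r\<bar> < \<epsilon> \<Longrightarrow> (y, s) \<in> T"
    using weak_star_box_nhd[OF T(1,2)] by metis
  have dual: "y \<in> topological_dual" "linear y" if "(y, s) \<in> ?A" for y s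
    using that by (auto simp: mem_epi_union topological_dual_def)
  have xs_lin: "linear xs" using xs by (simp add: topological_dual_def)
  have far: "\<not> \<bar>s - r\<bar> < \<epsilon>" if "(y, s) \<in> ?A" "\<And>i. i \<in> F \<Longrightarrow> \<bar>y i - xs i\<bar> < \<epsilon>" for y s
    using box[OF dual(1)[OF that(1)] that(2)] T(3) that(1) by blast
  have conv: "(\<lambda>x. u * y x + v * z x, u * s + v * t) \<in> ?A"
    if "(y, s) \<in> ?A" "(z, t) \<in> ?A" "0 \<le> u" "0 \<le> v" "u + v = 1" for y s z t u v
    by (rule epi_union_convex[OF f g that])
  have "\<exists>z \<tau>. \<forall>(y, s)\<in>?A. y z - \<tau> * s \<le> xs z - \<tau> * r - \<epsilon>"
    by (rule weak_star_separation[OF _ _ xs_lin F]) (fact conv, fact dual(2), fact far)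
  then obtain z \<tau> where sep: "\<And>y s. (y, s) \<in> ?A \<Longrightarrow> y z - \<tau> * s \<le> xs z - \<tau> * r - \<epsilon>"
    by blast
  obtain \<beta> where \<beta>: "f x1 = ereal \<beta>"
    using x1(2) closed_convexD(3)[OF f, of x1] by (cases "f x1") auto
  have at_x1: "y x1 - s \<le> \<beta>" if ys: "(y, s) \<in> ?A" for y s
  proof -
    obtain l where l: "l \<in> nonneg_finsupp" "ereal (y x1 - s) \<le> lagrangian f g l x1"
      using ys by (auto simp: mem_epi_union)
    from order_trans[OF l(2) lagrangian_le[OF l(1) x1(1)]]
    have "ereal (y x1 - s) \<le> ereal \<beta>" by (simp only: \<beta>)
    then show ?thesis by simp
  qed
  have "\<tau> \<ge> 0"
  proof (rule ccontr)
    assume "\<not> ?thesis"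
    then have neg: "- \<tau> > 0" by simp
    \<comment> \<open>A point of the union can be moved upwards indefinitely, which a negative \<open>\<tau>\<close> would forbid.\<close>
    have "?A \<noteq> {}"
    proof
      assume "?A = {}"
      then have "f x1 + delta (feasible_set g) x1 \<le> ereal (\<beta> - 1)"
        by (intro constrained_le_sup_affine[OF f g x1]) auto
      then show False using x1(1) by (simp add: \<beta> delta_def)
    qed
    then obtain y s where ys: "(y, s) \<in> ?A" by auto
    define K where "K = xs z - \<tau> * r - \<epsilon>"
    define t where "t = (\<bar>K - y z + \<tau> * s\<bar> + 1) / (- \<tau>)"
    have t: "t > 0" using neg unfolding t_def by (intro divide_pos_pos) auto
    have "(y, s + t) \<in> ?A"
    proof -
      obtain l where l: "l \<in> nonneg_finsupp" "\<And>x. ereal (y x - s) \<le> lagrangian f g l x"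
        using ys by (auto simp: mem_epi_union)
      have "ereal (y x - (s + t)) \<le> lagrangian f g l x" for x
        by (rule order_trans[OF _ l(2)]) (use t in simp)
      then show ?thesis using l(1) dual(1)[OF ys] by (auto simp: mem_epi_union)
    qed
    from sep[OF this] have "y z - \<tau> * s + (- \<tau>) * t \<le> K" by (simp add: K_def algebra_simps)
    moreover have "(- \<tau>) * t = \<bar>K - y z + \<tau> * s\<bar> + 1" using neg by (simp add: t_def)
    ultimately show False by linarith
  qed
  \<comment> \<open>The separating gap survives as long as \<open>\<delta> * D < \<epsilon>\<close>, which dictates the choice of \<open>\<delta>\<close>.\<close>
  define D where "D = r + \<beta> - xs x1"
  define \<delta> where "\<delta> = \<epsilon> / (\<bar>D\<bar> + 1)"
  have \<delta>: "\<delta> > 0" using \<epsilon> unfolding \<delta>_def by (intro divide_pos_pos) auto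
  have "\<delta> * (\<bar>D\<bar> + 1) = \<epsilon>" by (simp add: \<delta>_def)
  moreover have "\<delta> * D < \<delta> * (\<bar>D\<bar> + 1)" using \<delta> by (intro mult_strict_left_mono) auto
  ultimately have small: "\<delta> * D < \<epsilon>" by simp
  define \<sigma> where "\<sigma> = \<tau> + \<delta>"
  have \<sigma>: "\<sigma> > 0" using \<open>\<tau> \<ge> 0\<close> \<delta> by (simp add: \<sigma>_def)
  define w where "w = (1 / \<sigma>) *\<^sub>R (z + \<delta> *\<^sub>R x1)"
  define \<gamma> where "\<gamma> = (xs z - \<tau> * r - \<epsilon> + \<delta> * \<beta>) / \<sigma>"
  have at_w: "\<sigma> * y w = y z + \<delta> * y x1" if "linear y" for y
    using \<sigma> by (simp add: w_def linear_scale[OF that] linear_add[OF that])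
  have "f w + delta (feasible_set g) w \<le> ereal \<gamma>"
  proof (rule constrained_le_sup_affine[OF f g x1])
    fix y s assume ys: "(y, s) \<in> ?A"
    have "\<delta> * (y x1 - s) \<le> \<delta> * \<beta>" using at_x1[OF ys] \<delta> by (intro mult_left_mono) auto
    then have "\<sigma> * (y w - s) \<le> xs z - \<tau> * r - \<epsilon> + \<delta> * \<beta>"
      using sep[OF ys] at_w[OF dual(2)[OF ys]] by (simp add: \<sigma>_def algebra_simps)
    then show "y w - s \<le> \<gamma>" using \<sigma> by (simp add: \<gamma>_def field_simps)
  qed
  then have "ereal (xs w - r) \<le> ereal \<gamma>" using le[of w] by order
  then have "\<sigma> * (xs w - r) \<le> xs z - \<tau> * r - \<epsilon> + \<delta> * \<beta>" using \<sigma> by (simp add: \<gamma>_def field_simps)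
  then have "\<epsilon> \<le> \<delta> * D" using at_w[OF xs_lin] by (simp add: \<sigma>_def D_def algebra_simps)
  then show False using small by simp
qed

theorem closure_epi_union:
  assumes f: "closed_convex f" and g: "\<And>k. k \<ge> 1 \<Longrightarrow> closed_convex (g k)"
    and x1: "x1 \<in> feasible_set g" "f x1 < \<infinity>"
  shows "prod_topology weak_star euclideanreal closure_of (epi_union f g)
    = epi_conjugate (\<lambda>x. f x + delta (feasible_set g) x)"
proof (rule set_eqI, rule iffI)
  fix p assume p: "p \<in> prod_topology weak_star euclideanreal closure_of (epi_union f g)"
  obtain y r where yr: "p = (y, r)" by (cases p)
  show "p \<in> epi_conjugate (\<lambda>x. f x + delta (feasible_set g) x)"
    using closure_epi_union_sound[OF f p[unfolded yr]]
    unfolding yr epi_conjugate_def conjugate_le_iff by blast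
next
  fix p assume p: "p \<in> epi_conjugate (\<lambda>x. f x + delta (feasible_set g) x)"
  obtain y r where yr: "p = (y, r)" by (cases p)
  have "y \<in> topological_dual" "\<And>x. ereal (y x - r) \<le> f x + delta (feasible_set g) x"
    using p unfolding yr epi_conjugate_def conjugate_le_iff by blast+
  then show "p \<in> prod_topology weak_star euclideanreal closure_of (epi_union f g)"
    unfolding yr by (intro closure_epi_union_complete[OF f g x1])
qed

section \<open>Attained duality\<close>

lemma weak_duality:
  assumes f: "closed_convex f" and l: "l \<in> nonneg_finsupp"
  shows "conjugate (\<lambda>x. f x + delta (feasible_set g) x) y \<le> conjugate (lagrangian f g l) y"
  unfolding conjugate_def
  by (intro SUP_mono' ereal_minus_mono order_refl lagrangian_le_constrained[OF l] closed_convexD(3)[OF f])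

lemma is_attained_minI:
  assumes "\<And>u. u \<in> S \<Longrightarrow> v \<le> F u" "u \<in> S" "F u \<le> v"
  shows "is_attained_min v S F"
proof -
  have eq: "(INF u\<in>S. F u) = v"
    using assms by (intro antisym INF_greatest INF_lower2[of u]) auto
  moreover have "F u = v" using assms by (intro antisym) auto
  ultimately show ?thesis using assms(2) by (auto simp: is_attained_min_def)
qed

lemma lagrangian_truncated:
  "f x + (\<Sum>k=1..m. ereal (\<mu> k) * g k x) = lagrangian f g (\<lambda>k. if k \<in> {1..m} then \<mu> k else 0) x"
  by (subst lagrangian_superset[of "{1..m}"]) (auto intro!: sum.cong)

lemma truncated_nonneg_finsupp:
  "\<mu> \<in> {1..m} \<rightarrow>\<^sub>E {0..} \<Longrightarrow> (\<lambda>k. if k \<in> {1..m} then \<mu> k else 0) \<in> nonneg_finsupp"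
  by (auto simp: nonneg_finsupp_def PiE_iff intro: finite_subset[of _ "{1..m}"])

theorem theorem5p2:
  fixes f :: "'a::locally_convex_t2_space \<Rightarrow> ereal"
    and g :: "nat \<Rightarrow> 'a \<Rightarrow> ereal"
    and xs :: "'a \<Rightarrow> real"
  assumes "f \<in> Gamma_class"
    and "\<And>k. k \<ge> 1 \<Longrightarrow> g k \<in> Gamma_class"
    and "feasible_set g \<inter> effective_domain f \<noteq> {}"
    and "xs \<in> topological_dual"
  shows "(\<forall>\<^sub>F m in sequentially.
      is_attained_min (conjugate (\<lambda>x. f x + delta (feasible_set g) x) xs)
        ({1..m} \<rightarrow>\<^sub>E {0::real..})
        (\<lambda>\<mu>. conjugate (\<lambda>x. f x + (\<Sum>k=1..m. ereal (\<mu> k) * g k x)) xs))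
    \<longleftrightarrow> weak_star_closed_regarding (epi_union f g) ({xs} \<times> UNIV)"
proof -
  have f: "closed_convex f" and g: "\<And>k. k \<ge> 1 \<Longrightarrow> closed_convex (g k)"
    using assms(1,2) by (auto intro: Gamma_class_closed_convex)
  obtain x1 where x1: "x1 \<in> feasible_set g" "f x1 < \<infinity>"
    using assms(3) by (auto simp: effective_domain_def)
  define v where "v = conjugate (\<lambda>x. f x + delta (feasible_set g) x) xs"
  define extend where "extend m \<mu> = (\<lambda>k. if k \<in> {1..m} then \<mu> k else (0::real))" for m :: nat and \<mu>
  define attained where "attained m \<longleftrightarrow> is_attained_min v ({1..m} \<rightarrow>\<^sub>E {0::real..})
    (\<lambda>\<mu>. conjugate (lagrangian f g (extend m \<mu>)) xs)" for m
  have extend: "extend m \<mu> \<in> nonneg_finsupp" if "\<mu> \<in> {1..m} \<rightarrow>\<^sub>E {0..}" for m \<mu>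
    using truncated_nonneg_finsupp[OF that] by (simp add: extend_def)
  have closure: "prod_topology weak_star euclideanreal closure_of (epi_union f g)
      = epi_conjugate (\<lambda>x. f x + delta (feasible_set g) x)"
    by (rule closure_epi_union[OF f g x1])
  have epi: "(xs, r) \<in> epi_conjugate (\<lambda>x. f x + delta (feasible_set g) x) \<longleftrightarrow> v \<le> ereal r" for r
    using assms(4) by (simp add: epi_conjugate_def v_def)
  have closed: "weak_star_closed_regarding (epi_union f g) ({xs} \<times> UNIV) \<longleftrightarrow>
      (\<forall>r. v \<le> ereal r \<longleftrightarrow> (xs, r) \<in> epi_union f g)"
    unfolding weak_star_closed_regarding_def closure epi[symmetric] by blast
  have mem: "(xs, r) \<in> epi_union f g \<longleftrightarrow> (\<exists>l\<in>nonneg_finsupp. conjugate (lagrangian f g l) xs \<le> ereal r)" for r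
    using assms(4) by (simp add: mem_epi_union conjugate_le_iff)
  have dual: "v \<le> conjugate (lagrangian f g l) xs" if "l \<in> nonneg_finsupp" for l
    unfolding v_def by (rule weak_duality[OF f that])
  have "(\<forall>\<^sub>F m in sequentially. attained m) \<longleftrightarrow> (\<forall>r. v \<le> ereal r \<longleftrightarrow> (xs, r) \<in> epi_union f g)"
  proof
    assume "\<forall>\<^sub>F m in sequentially. attained m"
    then obtain m where "attained m" by (auto simp: eventually_sequentially)
    then obtain \<mu> where \<mu>: "\<mu> \<in> {1..m} \<rightarrow>\<^sub>E {0..}" "conjugate (lagrangian f g (extend m \<mu>)) xs = v"
      unfolding attained_def is_attained_min_def by metis
    show "\<forall>r. v \<le> ereal r \<longleftrightarrow> (xs, r) \<in> epi_union f g"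
    proof (intro allI iffI)
      fix r assume "v \<le> ereal r"
      then show "(xs, r) \<in> epi_union f g" using extend[OF \<mu>(1)] \<mu>(2) unfolding mem by blast
    next
      fix r assume "(xs, r) \<in> epi_union f g"
      then show "v \<le> ereal r" using dual order_trans unfolding mem by blast
    qed
  next
    assume R: "\<forall>r. v \<le> ereal r \<longleftrightarrow> (xs, r) \<in> epi_union f g"
    have "\<exists>l\<in>nonneg_finsupp. conjugate (lagrangian f g l) xs \<le> v"
    proof (cases v)
      case (real r)
      then show ?thesis using R mem[of r] by auto
    next
      case PInf
      \<comment> \<open>Any multiplier attains the value \<open>\<infinity>\<close>.\<close>
      then show ?thesis by (intro bexI[of _ "\<lambda>_. 0"]) (auto simp: nonneg_finsupp_def)
    next
      case MInf
      \<comment> \<open>This case is void, since the constrained problem has the feasible point \<open>x1\<close>.\<close>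
      have "ereal (xs x1) - f x1 \<le> v"
        unfolding v_def conjugate_def by (rule SUP_upper2[of x1]) (use x1 in \<open>auto simp: delta_def\<close>)
      then show ?thesis using MInf x1(2) by (cases "f x1") auto
    qed
    then obtain l where l: "l \<in> nonneg_finsupp" "conjugate (lagrangian f g l) xs \<le> v" by blast
    have "finite {k. l k \<noteq> 0}" using l(1) by (simp add: nonneg_finsupp_def)
    then obtain M where M: "\<And>k. l k \<noteq> 0 \<Longrightarrow> k \<le> M"
      using finite_nat_set_iff_bounded_le by auto
    show "\<forall>\<^sub>F m in sequentially. attained m"
      unfolding eventually_sequentially
    proof (intro exI allI impI)
      fix m assume m: "M \<le> m"
      have eq: "extend m (restrict l {1..m}) = l"
      proof
        fix k
        have "k \<in> {1..m}" if "l k \<noteq> 0"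
          using that M[OF that] m l(1) by (auto simp: nonneg_finsupp_def)
        then show "extend m (restrict l {1..m}) k = l k" by (auto simp: extend_def)
      qed
      have "restrict l {1..m} \<in> {1..m} \<rightarrow>\<^sub>E {0..}" using l(1) by (auto simp: nonneg_finsupp_def)
      then show "attained m"
        unfolding attained_def
        by (rule is_attained_minI[rotated]) (use l(2) dual extend in \<open>simp_all only: eq\<close>)
    qed
  qed
  then show ?thesis
    unfolding closed attained_def extend_def v_def lagrangian_truncated .
qed

end
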